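(* For every $m,n\in\mathbb Z_+$ the map $\psi_{m,n}\colon\mathbbm k\mathcal F_{\mathbf{Ab}}(x_1,\dots,x_m)^{\otimes n}\to\mathcal P_{\mathbf{CommCocHopf}}(\mathbbm k)(m,n)$ is a linear bijection. Moreover, if $\mathcal F_{\mathbf{Ab}}(x_1,x_2,\dots)$ is the free abelian group of countable rank, then the (multilinear) polynomial identities with coefficients in $\mathbbm k$ of the group Hopf algebra $\mathbbm k\mathcal F_{\mathbf{Ab}}(x_1,x_2,\dots)$ are generated by $V_{\mathbf{CommCocHopf}}$, i.e. (over the Hopf algebra axioms) by the commutativity identity $xy-yx\equiv0$ and the cocommutativity identity $x_{(1)}\otimes x_{(2)}-x_{(2)}\otimes x_{(1)}\equiv0$.
   Context: $\mathbbm k$ is a field. Let $\Omega=\{\mu,u,\Delta,\varepsilon,S\}$ with $(s,t)$ equal to $(2,1),(0,1),(1,2),(1,0),(1,1)$ respectively. $\mathcal M(\Omega)$ is the free braided strict monoidal category on one object $1$ and morphisms $\omega\colon1^{\otimes s(\omega)}\to1^{\otimes t(\omega)}$ (objects $\mathbb Z_+$, $m\otimes n=m+n$, morphisms generated by identities, braidings $\tau_{m,n}$, their inverses and the $\omega$'s modulo the relations of a braided strict monoidal category); $\mathcal P(\mathbbm k,\Omega)(m,n)$ is the vector space with basis $\mathcal M(\Omega)(m,n)$. For $V\subseteq\mathcal P(\mathbbm k,\Omega)$, $\mathcal P_V(\mathbbm k,\Omega)$ is the quotient by the smallest monoidal ideal (subspaces closed under composition on both sides and $\otimes$ with arbitrary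 morphisms) containing $V$. A Hopf algebra $H$ is an $\Omega$-algebra; $\mathcal E_H\colon\mathcal P(\mathbbm k,\Omega)\to\mathbf{Vect}_{\mathbbm k}$ is the linear braided monoidal functor with $n\mapsto H^{\otimes n}$, $\omega\mapsto$ structure map, $\tau_{m,n}\mapsto$ flip; $f\equiv 0$ is a polynomial identity of $H$ if $\mathcal E_H(f)=0$; $V$ generates the identities of $H$ if $\mathcal E_H$ vanishes on $V$ and every identity of $H$ has zero image in $\mathcal P_V(\mathbbm k,\Omega)$. $V_{\mathbf{Hopf}}$ consists of $\tau_{1,1}^2-\mathrm{id}_2$, $\mu(\mu\otimes\mathrm{id}_1)-\mu(\mathrm{id}_1\otimes\mu)$, $\mu(u\otimes\mathrm{id}_1)-\mathrm{id}_1$, $\mu(\mathrm{id}_1\otimes u)-\mathrm{id}_1$, $(\Delta\otimes\mathrm{id}_1)\Delta-(\mathrm{id}_1\otimes\Delta)\Delta$, $(\varepsilon\otimes\mathrm{id}_1)\Delta-\mathrm{id}_1$, $(\mathrm{id}_1\otimes\varepsilon)\Delta-\mathrm{id}_1$, $\varepsilon u-\mathrm{id}_0$, $\varepsilon\mu-\varepsilon\otimes\varepsilon$, $\Delta u-u\otimes u$, $\Delta\mu-(\mu\otimes\mu)(\mathrm{id}_1\otimes\tau_{1,1}\otimes\mathrm{id}_1)(\Delta\otimes\Delta)$, $\mu(S\otimes\mathrm{id}_1)\Delta-u\varepsilon$, $\mu(\mathrm{id}_1\otimes S)\Delta-u\varepsilon$. $V_{\mathbf{CommCocHopf}}:=V_{\mathbf{Hopf}}\cup\{\Delta-\tau_{1,1}\Delta,\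 \mu-\mu\tau_{1,1}\}$, $\mathcal P_{\mathbf{CommCocHopf}}(\mathbbm k):=\mathcal P_{V_{\mathbf{CommCocHopf}}}(\mathbbm k,\Omega)$. Functional notation: an expression in $x_1,\dots,x_m$ denotes the morphism that applies to the $q$-th input $\varepsilon$ (written $\varepsilon(x_q)$) or the iterated comultiplication producing $x_{q(1)}\otimes\dots\otimes x_{q(p)}$ (with $x_{q(1)}:=x_q$ if $p=1$), then permutes factors by symmetric braidings, applies $S$ where indicated, multiplies juxtaposed factors by $\mu$, and uses $u$ for empty products. $\mathcal F_{\mathbf{Ab}}(x_1,\dots,x_m)$ is the free abelian group written multiplicatively; the standard basis of $\mathbbm k\mathcal F_{\mathbf{Ab}}(x_1,\dots,x_m)^{\otimes n}$ consists of $g=\bigotimes_{k=1}^n\prod_{r=1}^m x_r^{s_{kr}}$, $s_{kr}\in\mathbb Z$. Then $\psi_{m,n}(g):=\varepsilon(x_{i_1})\cdots\varepsilon(x_{i_s})\bigotimes_{k=1}^n\prod_{r=1}^m\prod_{j=1}^{p_{kr}}S^{\alpha_{kr}}x_{r(\beta_{krj})}$, where $p_{kr}:=|s_{kr}|$, $\alpha_{kr}:=0$ if $s_{kr}\geqslant0$ and $1$ otherwise, $\{i_1<\dots<i_s\}=\{r\mid \sum_k p_{kr}=0\}$, for each $r$ the sequence $(\beta_{1r1},\dots,\beta_{1rp_{1r}},\beta_{2r1},\dots,\beta_{nrp_{nr}})=(1,2,\dots,\sum_kp_{kr})$, and $x_{r(1)}:=x_r$ if $\sum_kp_{kr}=1$;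 $\psi_{m,n}$ is extended linearly. *)

theory Defs
  imports Main "HOL-Library.Poly_Mapping"
begin

datatype gen = Mu | Unit | Delta | Eps | Ant

fun gsrc :: "gen \<Rightarrow> nat" where
  "gsrc Mu = 2" | "gsrc Unit = 0" | "gsrc Delta = 1" | "gsrc Eps = 1" | "gsrc Ant = 1"

fun gtgt :: "gen \<Rightarrow> nat" where
  "gtgt Mu = 1" | "gtgt Unit = 1" | "gtgt Delta = 2" | "gtgt Eps = 0" | "gtgt Ant = 1"

text \<open>Terms: identities, braidings tau_{m,n} : m+n -> n+m, their inverses
  (BrI m n : n+m -> m+n), generators, composition (Comp f g = f o g) and tensor.\<close>
datatype tm = Id nat | Br nat nat | BrI nat nat | Gen gen | Comp tm tm | Tens tm tm

fun src :: "tm \<Rightarrow> nat" where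
  "src (Id n) = n"
| "src (Br a b) = a + b"
| "src (BrI a b) = b + a"
| "src (Gen w) = gsrc w"
| "src (Comp f g) = src g"
| "src (Tens f g) = src f + src g"

fun tgt :: "tm \<Rightarrow> nat" where
  "tgt (Id n) = n"
| "tgt (Br a b) = b + a"
| "tgt (BrI a b) = a + b"
| "tgt (Gen w) = gtgt w"
| "tgt (Comp f g) = tgt f"
| "tgt (Tens f g) = tgt f + tgt g"

fun wf :: "tm \<Rightarrow> bool" where
  "wf (Comp f g) = (wf f \<and> wf g \<and> src f = tgt g)"
| "wf (Tens f g) = (wf f \<and> wf g)"
| "wf _ = True"

inductive beq :: "tm \<Rightarrow> tm \<Rightarrow> bool" where
  assoc: "\<lbrakk>wf f; wf g; wf h; src f = tgt g; src g = tgt h\<rbrakk>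
     \<Longrightarrow> beq (Comp (Comp f g) h) (Comp f (Comp g h))"
| idL: "wf f \<Longrightarrow> beq (Comp (Id (tgt f)) f) f"
| idR: "wf f \<Longrightarrow> beq (Comp f (Id (src f))) f"
| tassoc: "\<lbrakk>wf f; wf g; wf h\<rbrakk> \<Longrightarrow> beq (Tens (Tens f g) h) (Tens f (Tens g h))"
| tunitL: "wf f \<Longrightarrow> beq (Tens (Id 0) f) f"
| tunitR: "wf f \<Longrightarrow> beq (Tens f (Id 0)) f"
| tid: "beq (Tens (Id m) (Id n)) (Id (m + n))"
| interchange: "\<lbrakk>wf f; wf f'; wf g; wf g'; src f = tgt f'; src g = tgt g'\<rbrakk>
     \<Longrightarrow> beq (Comp (Tens f g) (Tens f' g')) (Tens (Comp f f') (Comp g g'))"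
| brinv1: "beq (Comp (Br m n) (BrI m n)) (Id (n + m))"
| brinv2: "beq (Comp (BrI m n) (Br m n)) (Id (m + n))"
| natural: "\<lbrakk>wf f; wf g\<rbrakk>
     \<Longrightarrow> beq (Comp (Br (tgt f) (tgt g)) (Tens f g)) (Comp (Tens g f) (Br (src f) (src g)))"
| hex1: "beq (Br l (m + n)) (Comp (Tens (Id m) (Br l n)) (Tens (Br l m) (Id n)))"
| hex2: "beq (Br (l + m) n) (Comp (Tens (Br l n) (Id m)) (Tens (Id l) (Br m n)))"

type_synonym 'k lc = "tm \<Rightarrow> 'k"

definition lc_of :: "tm \<Rightarrow> 'k::field lc" where
  "lc_of t = (\<lambda>h. if h = t then 1 else 0)"

definition lc_compR :: "'k::field lc \<Rightarrow> tm \<Rightarrow> 'k lc" where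
  "lc_compR a g = (\<lambda>h. case h of Comp f g' \<Rightarrow> if g' = g then a f else 0 | _ \<Rightarrow> 0)"
definition lc_compL :: "tm \<Rightarrow> 'k::field lc \<Rightarrow> 'k lc" where
  "lc_compL g a = (\<lambda>h. case h of Comp g' f \<Rightarrow> if g' = g then a f else 0 | _ \<Rightarrow> 0)"
definition lc_tensR :: "'k::field lc \<Rightarrow> tm \<Rightarrow> 'k lc" where
  "lc_tensR a g = (\<lambda>h. case h of Tens f g' \<Rightarrow> if g' = g then a f else 0 | _ \<Rightarrow> 0)"
definition lc_tensL :: "tm \<Rightarrow> 'k::field lc \<Rightarrow> 'k lc" where
  "lc_tensL g a = (\<lambda>h. case h of Tens g' f \<Rightarrow> if g' = g then a f else 0 | _ \<Rightarrow> 0)"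

definition Pmn :: "nat \<Rightarrow> nat \<Rightarrow> 'k::field lc set" where
  "Pmn m n = {c. finite {t. c t \<noteq> 0} \<and> (\<forall>t. c t \<noteq> 0 \<longrightarrow> wf t \<and> src t = m \<and> tgt t = n)}"

text \<open>The smallest monoidal ideal containing V, together with the relations presenting
  M(Omega) (so that the quotient of the span of terms by it is P_V(k,Omega)).\<close>
inductive inI :: "(nat \<times> nat \<times> 'k::field lc) set \<Rightarrow> nat \<Rightarrow> nat \<Rightarrow> 'k lc \<Rightarrow> bool"
  for V :: "(nat \<times> nat \<times> 'k::field lc) set" where
  gen: "(m, n, v) \<in> V \<Longrightarrow> inI V m n v"
| rel: "beq t t' \<Longrightarrow> wf t \<Longrightarrow> inI V (src t) (tgt t) (\<lambda>h. lc_of t h - lc_of t' h)"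
| zero: "inI V m n (\<lambda>h. 0)"
| add: "inI V m n a \<Longrightarrow> inI V m n b \<Longrightarrow> inI V m n (\<lambda>h. a h + b h)"
| smult: "inI V m n a \<Longrightarrow> inI V m n (\<lambda>h. k * a h)"
| compR: "inI V m n a \<Longrightarrow> wf g \<Longrightarrow> tgt g = m \<Longrightarrow> inI V (src g) n (lc_compR a g)"
| compL: "inI V m n a \<Longrightarrow> wf g \<Longrightarrow> src g = n \<Longrightarrow> inI V m (tgt g) (lc_compL g a)"
| tensR: "inI V m n a \<Longrightarrow> wf g \<Longrightarrow> inI V (m + src g) (n + tgt g) (lc_tensR a g)"
| tensL: "inI V m n a \<Longrightarrow> wf g \<Longrightarrow> inI V (src g + m) (tgt g + n) (lc_tensL g a)"

definition qcls :: "(nat \<times> nat \<times> 'k::field lc) set \<Rightarrow> nat \<Rightarrow> nat \<Rightarrow> 'k lc \<Rightarrow> 'k lc set" where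
  "qcls V m n c = {d \<in> Pmn m n. inI V m n (\<lambda>h. c h - d h)}"

definition lc_diff :: "tm \<Rightarrow> tm \<Rightarrow> 'k::field lc" where
  "lc_diff t t' = (\<lambda>h. lc_of t h - lc_of t' h)"

definition V_Hopf :: "(nat \<times> nat \<times> 'k::field lc) set" where
  "V_Hopf = {
    (2, 2, lc_diff (Comp (Br 1 1) (Br 1 1)) (Id 2)),
    (3, 1, lc_diff (Comp (Gen Mu) (Tens (Gen Mu) (Id 1))) (Comp (Gen Mu) (Tens (Id 1) (Gen Mu)))),
    (1, 1, lc_diff (Comp (Gen Mu) (Tens (Gen Unit) (Id 1))) (Id 1)),
    (1, 1, lc_diff (Comp (Gen Mu) (Tens (Id 1) (Gen Unit))) (Id 1)),
    (1, 3, lc_diff (Comp (Tens (Gen Delta) (Id 1)) (Gen Delta)) (Comp (Tens (Id 1) (Gen Delta)) (Gen Delta))),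
    (1, 1, lc_diff (Comp (Tens (Gen Eps) (Id 1)) (Gen Delta)) (Id 1)),
    (1, 1, lc_diff (Comp (Tens (Id 1) (Gen Eps)) (Gen Delta)) (Id 1)),
    (0, 0, lc_diff (Comp (Gen Eps) (Gen Unit)) (Id 0)),
    (2, 0, lc_diff (Comp (Gen Eps) (Gen Mu)) (Tens (Gen Eps) (Gen Eps))),
    (0, 2, lc_diff (Comp (Gen Delta) (Gen Unit)) (Tens (Gen Unit) (Gen Unit))),
    (2, 2, lc_diff (Comp (Gen Delta) (Gen Mu))
                   (Comp (Tens (Gen Mu) (Gen Mu))
                     (Comp (Tens (Tens (Id 1) (Br 1 1)) (Id 1)) (Tens (Gen Delta) (Gen Delta))))),
    (1, 1, lc_diff (Comp (Gen Mu) (Comp (Tens (Gen Ant) (Id 1)) (Gen Delta))) (Comp (Gen Unit) (Gen Eps))),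
    (1, 1, lc_diff (Comp (Gen Mu) (Comp (Tens (Id 1) (Gen Ant)) (Gen Delta))) (Comp (Gen Unit) (Gen Eps)))}"

definition V_CommCocHopf :: "(nat \<times> nat \<times> 'k::field lc) set" where
  "V_CommCocHopf = V_Hopf \<union> {
    (1, 2, lc_diff (Gen Delta) (Comp (Br 1 1) (Gen Delta))),
    (2, 1, lc_diff (Gen Mu) (Comp (Gen Mu) (Br 1 1)))}"

fun tens_list :: "tm list \<Rightarrow> tm" where
  "tens_list [] = Id 0"
| "tens_list (t # ts) = Tens t (tens_list ts)"

fun delta_iter :: "nat \<Rightarrow> tm" where
  "delta_iter 0 = Gen Eps"
| "delta_iter (Suc 0) = Id 1"
| "delta_iter (Suc (Suc p)) = Comp (Tens (Id 1) (delta_iter (Suc p))) (Gen Delta)"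

fun mult_iter :: "nat \<Rightarrow> tm" where
  "mult_iter 0 = Gen Unit"
| "mult_iter (Suc 0) = Id 1"
| "mult_iter (Suc (Suc p)) = Comp (Gen Mu) (Tens (Id 1) (mult_iter (Suc p)))"

definition swap_at :: "nat \<Rightarrow> nat \<Rightarrow> tm" where
  "swap_at j N = Tens (Tens (Id j) (Br 1 1)) (Id (N - j - 2))"

fun move_front :: "nat \<Rightarrow> nat \<Rightarrow> tm" where
  "move_front 0 N = Id N"
| "move_front (Suc j) N = Comp (move_front j N) (swap_at j N)"

text \<open>perm_term sigma : the permutation of strands such that output strand i carries
  input strand (sigma ! i), built from symmetric braidings.\<close>
function perm_term :: "nat list \<Rightarrow> tm" where
  "perm_term [] = Id 0"
| "perm_term (j # rest) =
     Comp (Tens (Id 1) (perm_term (map (\<lambda>x. if j < x then x - 1 else x) rest)))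
          (move_front j (Suc (length rest)))"
  by pat_completeness auto
termination by (relation "measure length") auto

text \<open>A basis element of (k F_Ab(x_1..x_m))^{(x)n} is given by an integer matrix
  s k r (k < n the tensor factor, r < m the generator), zero outside.\<close>
definition Mat :: "nat \<Rightarrow> nat \<Rightarrow> (nat \<Rightarrow> nat \<Rightarrow> int) set" where
  "Mat m n = {s. \<forall>k r. (n \<le> k \<or> m \<le> r) \<longrightarrow> s k r = 0}"

definition psi_tm :: "nat \<Rightarrow> nat \<Rightarrow> (nat \<Rightarrow> nat \<Rightarrow> int) \<Rightarrow> tm" where
  "psi_tm m n s =
    (let p = (\<lambda>k r. nat \<bar>s k r\<bar>);
         N = (\<lambda>r. \<Sum>k<n. p k r);
         pos = (\<lambda>r c. (\<Sum>r'<r. N r') + c);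
         off = (\<lambda>k r. \<Sum>k'<k. p k' r);
         L1 = tens_list (map (\<lambda>r. delta_iter (N r)) [0..<m]);
         sigma = concat (map (\<lambda>k. concat (map (\<lambda>r. map (\<lambda>j. pos r (off k r + j)) [0..<p k r])
                   [0..<m])) [0..<n]);
         L2 = perm_term sigma;
         L3 = tens_list (concat (map (\<lambda>k. concat (map (\<lambda>r.
                 replicate (p k r) (if s k r < 0 then Gen Ant else Id 1)) [0..<m])) [0..<n]));
         L4 = tens_list (map (\<lambda>k. mult_iter (\<Sum>r<m. p k r)) [0..<n])
     in Comp L4 (Comp L3 (Comp L2 L1)))"

definition Dom :: "nat \<Rightarrow> nat \<Rightarrow> ((nat \<Rightarrow> nat \<Rightarrow> int) \<Rightarrow> 'k::field) set" where
  "Dom m n = {c. finite {s. c s \<noteq> 0} \<and> (\<forall>s. c s \<noteq> 0 \<longrightarrow> s \<in> Mat m n)}"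

definition psi_lin :: "nat \<Rightarrow> nat \<Rightarrow> ((nat \<Rightarrow> nat \<Rightarrow> int) \<Rightarrow> 'k::field) \<Rightarrow> 'k lc" where
  "psi_lin m n c = (\<lambda>t. \<Sum>s\<in>{s. c s \<noteq> 0}. c s * lc_of (psi_tm m n s) t)"

text \<open>The free abelian group of countable rank, written additively: nat =>0 int.
  H^{(x)n} is identified with the space with basis (group elements)^n (lists of length n).
  evH t xs ys is the coefficient of the basis vector ys in E_H(t)(xs).\<close>
type_synonym grp = "nat \<Rightarrow>\<^sub>0 int"

definition delta :: "grp list \<Rightarrow> grp list \<Rightarrow> 'k::field" where
  "delta xs ys = (if xs = ys then 1 else 0)"

fun gen_ev :: "gen \<Rightarrow> grp list \<Rightarrow> grp list option" where
  "gen_ev Mu [g, h] = Some [g + h]"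
| "gen_ev Unit [] = Some [0]"
| "gen_ev Delta [g] = Some [g, g]"
| "gen_ev Eps [g] = Some []"
| "gen_ev Ant [g] = Some [- g]"
| "gen_ev _ _ = None"

fun evH :: "tm \<Rightarrow> grp list \<Rightarrow> grp list \<Rightarrow> 'k::field" where
  "evH (Id n) xs = delta xs"
| "evH (Br a b) xs = delta (drop a xs @ take a xs)"
| "evH (BrI a b) xs = delta (drop b xs @ take b xs)"
| "evH (Gen w) xs = (case gen_ev w xs of Some ys \<Rightarrow> delta ys | None \<Rightarrow> (\<lambda>_. 0))"
| "evH (Comp f g) xs = (\<lambda>ys. \<Sum>zs\<in>{zs. evH g xs zs \<noteq> 0}. evH g xs zs * evH f zs ys)"
| "evH (Tens f g) xs = (\<lambda>ys. evH f (take (src f) xs) (take (tgt f) ys)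
                             * evH g (drop (src f) xs) (drop (tgt f) ys))"

definition is_identity :: "nat \<Rightarrow> nat \<Rightarrow> 'k::field lc \<Rightarrow> bool" where
  "is_identity m n c \<longleftrightarrow>
     (\<forall>xs ys. length xs = m \<longrightarrow> (\<Sum>t\<in>{t. c t \<noteq> 0}. c t * evH t xs ys) = 0)"

definition generates_identities :: "(nat \<times> nat \<times> 'k::field lc) set \<Rightarrow> bool" where
  "generates_identities V \<longleftrightarrow>
     (\<forall>(m, n, v)\<in>V. is_identity m n v) \<and>
     (\<forall>m n c. c \<in> Pmn m n \<longrightarrow> is_identity m n c \<longrightarrow> inI V m n c)"

end

(* The bicommutative Hopf relations make the quotient category a category of terms with cocommutative
   comonoids Dn n on all objects. For every l the comonoid morphisms from l to the generating object
   form an abelian group under convolution, and every term acts on tuples of its elements exactly as it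
   acts on group-like elements of the group algebra of a free abelian group. Since the tuple of
   projections is the identity, a term is determined modulo the relations by its action on free
   generators, i.e. by an integer matrix; the term psi_tm m n s realises the matrix s. *)
theory Submission
  imports Defs "HOL-Algebra.FiniteProduct"
begin

section \<open>The symmetric monoidal category of terms\<close>

text \<open>On cocommutative comonoids the tensor product is the categorical product, so a
  bicommutative Hopf monoid is an abelian group object; the proof is a Yoneda argument for it, the
  projections being the generic points. What is checked is only how each generator of the category
  acts on tuples of comonoid morphisms. The obstacle is braid bookkeeping: symmetry is imposed on
  the elementary braiding alone, so coassociativity and cocommutativity of all tensor powers must be
  derived from naturality and the hexagons. Injectivity goes the opposite way. Everything in the
  ideal acts as zero on group elements, and distinct tuples of group elements are linearly
  independent, so each coefficient of a normal form can be read off from its value on free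
  generators. The relations are kept as pairs of terms without coefficients; the linear ideal enters
  only when the result on single terms is extended to linear combinations.\<close>

inductive hopf_axiom :: "tm \<Rightarrow> tm \<Rightarrow> bool" where
  "hopf_axiom (Comp (Br 1 1) (Br 1 1)) (Id 2)"
| "hopf_axiom (Comp (Gen Mu) (Tens (Gen Mu) (Id 1))) (Comp (Gen Mu) (Tens (Id 1) (Gen Mu)))"
| "hopf_axiom (Comp (Gen Mu) (Tens (Gen Unit) (Id 1))) (Id 1)"
| "hopf_axiom (Comp (Gen Mu) (Tens (Id 1) (Gen Unit))) (Id 1)"
| "hopf_axiom (Comp (Tens (Gen Delta) (Id 1)) (Gen Delta)) (Comp (Tens (Id 1) (Gen Delta)) (Gen Delta))"
| "hopf_axiom (Comp (Tens (Gen Eps) (Id 1)) (Gen Delta)) (Id 1)"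
| "hopf_axiom (Comp (Tens (Id 1) (Gen Eps)) (Gen Delta)) (Id 1)"
| "hopf_axiom (Comp (Gen Eps) (Gen Unit)) (Id 0)"
| "hopf_axiom (Comp (Gen Eps) (Gen Mu)) (Tens (Gen Eps) (Gen Eps))"
| "hopf_axiom (Comp (Gen Delta) (Gen Unit)) (Tens (Gen Unit) (Gen Unit))"
| "hopf_axiom (Comp (Gen Delta) (Gen Mu))
     (Comp (Tens (Gen Mu) (Gen Mu))
       (Comp (Tens (Tens (Id 1) (Br 1 1)) (Id 1)) (Tens (Gen Delta) (Gen Delta))))"
| "hopf_axiom (Comp (Gen Mu) (Comp (Tens (Gen Ant) (Id 1)) (Gen Delta))) (Comp (Gen Unit) (Gen Eps))"
| "hopf_axiom (Comp (Gen Mu) (Comp (Tens (Id 1) (Gen Ant)) (Gen Delta))) (Comp (Gen Unit) (Gen Eps))"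
| "hopf_axiom (Gen Delta) (Comp (Br 1 1) (Gen Delta))"
| "hopf_axiom (Gen Mu) (Comp (Gen Mu) (Br 1 1))"

text \<open>This congruence does not mention the field, so that one quotient type serves all fields.\<close>
inductive eqv :: "tm \<Rightarrow> tm \<Rightarrow> bool" where
  eqv_beq: "beq t t' \<Longrightarrow> eqv t t'"
| eqv_axiom: "hopf_axiom t t' \<Longrightarrow> eqv t t'"
| eqv_refl: "wf t \<Longrightarrow> eqv t t"
| eqv_sym: "eqv t t' \<Longrightarrow> eqv t' t"
| eqv_trans: "eqv t t' \<Longrightarrow> eqv t' t'' \<Longrightarrow> eqv t t''"
| eqv_Comp: "eqv f f' \<Longrightarrow> eqv g g' \<Longrightarrow> src f = tgt g \<Longrightarrow> eqv (Comp f g) (Comp f' g')"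
| eqv_Tens: "eqv f f' \<Longrightarrow> eqv g g' \<Longrightarrow> eqv (Tens f g) (Tens f' g')"

lemma beq_typed: "beq t t' \<Longrightarrow> wf t \<and> wf t' \<and> src t = src t' \<and> tgt t = tgt t'"
  by (induction rule: beq.induct) auto

lemma hopf_axiom_typed: "hopf_axiom t t' \<Longrightarrow> wf t \<and> wf t' \<and> src t = src t' \<and> tgt t = tgt t'"
  by (induction rule: hopf_axiom.induct) auto

lemma eqv_typed: "eqv t t' \<Longrightarrow> wf t \<and> wf t' \<and> src t = src t' \<and> tgt t = tgt t'"
  by (induction rule: eqv.induct) (auto dest: beq_typed hopf_axiom_typed)

lemma eqv_self_iff: "eqv t t \<longleftrightarrow> wf t"
  using eqv_typed eqv_refl by blast

\<comment> \<open>The relation \<open>eqv\<close> is reflexive exactly at the well-formed terms, so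
  a partial quotient discards ill-typed terms and every element of \<open>mor\<close> has a source
  and a target.\<close>
quotient_type mor = tm / partial: eqv
proof (rule part_equivpI)
  show "\<exists>t. eqv t t"
    using eqv_refl[of "Id 0"] by auto
  show "symp eqv"
    by (blast intro: sympI eqv_sym)
  show "transp eqv"
    by (blast intro: transpI eqv_trans)
qed

lift_definition src_m :: "mor \<Rightarrow> nat" is src by (auto dest: eqv_typed)
lift_definition tgt_m :: "mor \<Rightarrow> nat" is tgt by (auto dest: eqv_typed)
lift_definition idm :: "nat \<Rightarrow> mor" is Id by (simp add: eqv_refl)
lift_definition br :: "nat \<Rightarrow> nat \<Rightarrow> mor" is Br by (simp add: eqv_refl)
lift_definition bri :: "nat \<Rightarrow> nat \<Rightarrow> mor" is BrI by (simp add: eqv_refl)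
lift_definition gn :: "gen \<Rightarrow> mor" is Gen by (simp add: eqv_refl)
lift_definition tns :: "mor \<Rightarrow> mor \<Rightarrow> mor" (infixr "\<otimes>\<^sub>m" 70) is Tens by (rule eqv_Tens)

text \<open>Composition is made total by a junk value on mismatched arguments.\<close>
lift_definition cmp :: "mor \<Rightarrow> mor \<Rightarrow> mor" (infixr "\<cdot>" 65)
  is "\<lambda>f g. if src f = tgt g then Comp f g else Id 0"
proof -
  fix f f' g g'
  assume "eqv f f'" "eqv g g'"
  then show "eqv (if src f = tgt g then Comp f g else Id 0)
      (if src f' = tgt g' then Comp f' g' else Id 0)"
    using eqv_typed[of f f'] eqv_typed[of g g'] by (simp add: eqv_Comp eqv_refl)
qed

lemma src_tgt_simps [simp]:
  "src_m (idm n) = n" "tgt_m (idm n) = n"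
  "src_m (br a b) = a + b" "tgt_m (br a b) = b + a"
  "src_m (bri a b) = b + a" "tgt_m (bri a b) = a + b"
  "src_m (gn w) = gsrc w" "tgt_m (gn w) = gtgt w"
  by (transfer, simp)+

lemma src_tns [simp]: "src_m (f \<otimes>\<^sub>m g) = src_m f + src_m g"
  by transfer simp
lemma tgt_tns [simp]: "tgt_m (f \<otimes>\<^sub>m g) = tgt_m f + tgt_m g"
  by transfer simp
lemma src_cmp [simp]: "src_m f = tgt_m g \<Longrightarrow> src_m (f \<cdot> g) = src_m g"
  by transfer auto
lemma tgt_cmp [simp]: "src_m f = tgt_m g \<Longrightarrow> tgt_m (f \<cdot> g) = tgt_m f"
  by transfer auto

lemma cmp_assoc: "src_m f = tgt_m g \<Longrightarrow> src_m g = tgt_m h \<Longrightarrow> (f \<cdot> g) \<cdot> h = f \<cdot> (g \<cdot> h)"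
  by transfer (auto simp: eqv_self_iff intro!: eqv_beq beq.intros)
lemma cmp_idL [simp]: "tgt_m f = n \<Longrightarrow> idm n \<cdot> f = f"
  by transfer (auto simp: eqv_self_iff intro!: eqv_beq beq.intros)
lemma cmp_idR [simp]: "src_m f = n \<Longrightarrow> f \<cdot> idm n = f"
  by transfer (auto simp: eqv_self_iff intro!: eqv_beq beq.intros)
lemma tns_assoc: "(f \<otimes>\<^sub>m g) \<otimes>\<^sub>m h = f \<otimes>\<^sub>m (g \<otimes>\<^sub>m h)"
  by transfer (auto simp: eqv_self_iff intro!: eqv_beq beq.intros)
lemma tns_unitL [simp]: "idm 0 \<otimes>\<^sub>m f = f"
  by transfer (auto simp: eqv_self_iff intro!: eqv_beq beq.intros)
lemma tns_unitR [simp]: "f \<otimes>\<^sub>m idm 0 = f"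
  by transfer (auto simp: eqv_self_iff intro!: eqv_beq beq.intros)
lemma tns_id: "idm m \<otimes>\<^sub>m idm n = idm (m + n)"
  by transfer (auto simp: eqv_self_iff intro!: eqv_beq beq.intros)
lemma tns_cmp: "src_m f = tgt_m f' \<Longrightarrow> src_m g = tgt_m g' \<Longrightarrow>
    (f \<otimes>\<^sub>m g) \<cdot> (f' \<otimes>\<^sub>m g') = (f \<cdot> f') \<otimes>\<^sub>m (g \<cdot> g')"
  by transfer (auto simp: eqv_self_iff intro!: eqv_beq beq.intros)
lemma bri_br: "bri m n \<cdot> br m n = idm (m + n)"
  by transfer (auto simp: eqv_self_iff intro!: eqv_beq beq.intros)
lemma br_natural: "src_m f = m \<Longrightarrow> tgt_m f = m' \<Longrightarrow> src_m g = n \<Longrightarrow> tgt_m g = n' \<Longrightarrow>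
    br m' n' \<cdot> (f \<otimes>\<^sub>m g) = (g \<otimes>\<^sub>m f) \<cdot> br m n"
  by transfer (auto simp: eqv_self_iff intro!: eqv_beq beq.intros)
lemma br_hex1: "br l (m + n) = (idm m \<otimes>\<^sub>m br l n) \<cdot> (br l m \<otimes>\<^sub>m idm n)"
  by transfer (auto simp: eqv_self_iff intro!: eqv_beq beq.intros)
lemma br_hex2: "br (l + m) n = (br l n \<otimes>\<^sub>m idm m) \<cdot> (idm l \<otimes>\<^sub>m br m n)"
  by transfer (auto simp: eqv_self_iff intro!: eqv_beq beq.intros)

abbreviation "mu \<equiv> gn Mu"
abbreviation "un \<equiv> gn Unit"
abbreviation "dl \<equiv> gn Delta"
abbreviation "ep \<equiv> gn Eps"
abbreviation "an \<equiv> gn Ant"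
abbreviation "id1 \<equiv> idm (Suc 0)"
abbreviation "tau \<equiv> br (Suc 0) (Suc 0)"

section \<open>The Hopf relations as equations between morphisms\<close>

lemma tau_tau: "tau \<cdot> tau = idm 2"
  by transfer (auto intro!: eqv_axiom hopf_axiom.intros[simplified])
lemma mu_assoc: "mu \<cdot> (mu \<otimes>\<^sub>m id1) = mu \<cdot> (id1 \<otimes>\<^sub>m mu)"
  by transfer (auto intro!: eqv_axiom hopf_axiom.intros[simplified])
lemma mu_un: "mu \<cdot> (un \<otimes>\<^sub>m id1) = id1" "mu \<cdot> (id1 \<otimes>\<^sub>m un) = id1"
  by (transfer; auto intro!: eqv_axiom hopf_axiom.intros[simplified])+
lemma dl_coassoc: "(dl \<otimes>\<^sub>m id1) \<cdot> dl = (id1 \<otimes>\<^sub>m dl) \<cdot> dl"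
  by transfer (auto intro!: eqv_axiom hopf_axiom.intros[simplified])
lemma ep_dl: "(ep \<otimes>\<^sub>m id1) \<cdot> dl = id1" "(id1 \<otimes>\<^sub>m ep) \<cdot> dl = id1"
  by (transfer; auto intro!: eqv_axiom hopf_axiom.intros[simplified])+
lemma ep_un: "ep \<cdot> un = idm 0"
  by transfer (auto intro!: eqv_axiom hopf_axiom.intros[simplified])
lemma ep_mu: "ep \<cdot> mu = ep \<otimes>\<^sub>m ep"
  by transfer (auto intro!: eqv_axiom hopf_axiom.intros[simplified])
lemma dl_un: "dl \<cdot> un = un \<otimes>\<^sub>m un"
  by transfer (auto intro!: eqv_axiom hopf_axiom.intros[simplified])
lemma dl_mu: "dl \<cdot> mu = (mu \<otimes>\<^sub>m mu) \<cdot> (id1 \<otimes>\<^sub>m tau \<otimes>\<^sub>m id1) \<cdot> (dl \<otimes>\<^sub>m dl)"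
  \<comment> \<open>The infix tensor associates to the right, whereas the relation brackets its
    middle factor to the left.\<close>
  unfolding tns_assoc[symmetric]
  by transfer (auto intro!: eqv_axiom hopf_axiom.intros[simplified])
lemma antipode: "mu \<cdot> (an \<otimes>\<^sub>m id1) \<cdot> dl = un \<cdot> ep" "mu \<cdot> (id1 \<otimes>\<^sub>m an) \<cdot> dl = un \<cdot> ep"
  by (transfer; auto intro!: eqv_axiom hopf_axiom.intros[simplified])+
lemma tau_dl: "tau \<cdot> dl = dl"
  by transfer (auto intro!: eqv_sym[OF eqv_axiom] hopf_axiom.intros[simplified])
lemma mu_tau: "mu \<cdot> tau = mu"
  by transfer (auto intro!: eqv_sym[OF eqv_axiom] hopf_axiom.intros[simplified])

text \<open>The hexagon at \<open>m = n = 0\<close> makes the braiding with the unit object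
  idempotent; an idempotent with a left inverse is an identity.\<close>

lemma br_0_right [simp]: "br l 0 = idm l"
proof -
  have "bri l 0 \<cdot> br l 0 = bri l 0 \<cdot> (br l 0 \<cdot> br l 0)"
    using br_hex1[of l 0 0] by simp
  also have "\<dots> = (bri l 0 \<cdot> br l 0) \<cdot> br l 0"
    by (simp add: cmp_assoc)
  finally show ?thesis
    by (simp add: bri_br)
qed

lemma br_0_left [simp]: "br 0 n = idm n"
proof -
  have "bri 0 n \<cdot> br 0 n = bri 0 n \<cdot> (br 0 n \<cdot> br 0 n)"
    using br_hex2[of 0 0 n] by simp
  also have "\<dots> = (bri 0 n \<cdot> br 0 n) \<cdot> br 0 n"
    by (simp add: cmp_assoc)
  finally show ?thesis
    by (simp add: bri_br)
qed

text \<open>Only the elementary braiding is an involution by axiom. The hexagons peel off one strand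
  on each side, the inner pair cancels by induction and the outer pair by
  \<open>tau_tau\<close>.\<close>

lemma br_1_symmetric: "br n (Suc 0) \<cdot> br (Suc 0) n = idm (Suc n)"
proof (induction n)
  case 0
  then show ?case by simp
next
  case (Suc n)
  have a: "br (Suc 0) (Suc n) = (id1 \<otimes>\<^sub>m br (Suc 0) n) \<cdot> (tau \<otimes>\<^sub>m idm n)"
    using br_hex1[of 1 1 n] by simp
  have b: "br (Suc n) (Suc 0) = (tau \<otimes>\<^sub>m idm n) \<cdot> (id1 \<otimes>\<^sub>m br n (Suc 0))"
    using br_hex2[of 1 n 1] by simp
  have "br (Suc n) (Suc 0) \<cdot> br (Suc 0) (Suc n)
      = (tau \<otimes>\<^sub>m idm n) \<cdot> ((id1 \<otimes>\<^sub>m br n (Suc 0)) \<cdot> (id1 \<otimes>\<^sub>m br (Suc 0) n)) \<cdot> (tau \<otimes>\<^sub>m idm n)"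
    unfolding a b by (simp add: cmp_assoc)
  also have "\<dots> = (tau \<otimes>\<^sub>m idm n) \<cdot> (tau \<otimes>\<^sub>m idm n)"
    by (simp add: tns_cmp Suc tns_id)
  also have "\<dots> = idm (Suc (Suc n))"
    by (simp add: tns_cmp tau_tau tns_id)
  finally show ?case .
qed

section \<open>Tensor powers as cocommutative comonoids\<close>

text \<open>This is the comultiplication of the tensor product of the generating comonoid with its
  \<open>n\<close>-th power: the braiding carries the second copy of the first factor past the first
  copies of the others, turning x x' y y' into x y x' y'.\<close>

fun Dn :: "nat \<Rightarrow> mor" where
  "Dn 0 = idm 0"
| "Dn (Suc n) = (id1 \<otimes>\<^sub>m br (Suc 0) n \<otimes>\<^sub>m idm n) \<cdot> (dl \<otimes>\<^sub>m Dn n)"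

fun En :: "nat \<Rightarrow> mor" where
  "En 0 = idm 0"
| "En (Suc n) = ep \<otimes>\<^sub>m En n"

lemma src_En [simp]: "src_m (En n) = n" and tgt_En [simp]: "tgt_m (En n) = 0"
  by (induction n) auto

lemma Dn_typed: "src_m (Dn n) = n \<and> tgt_m (Dn n) = n + n"
  by (induction n) auto
lemma src_Dn [simp]: "src_m (Dn n) = n" and tgt_Dn [simp]: "tgt_m (Dn n) = n + n"
  using Dn_typed by auto

lemma Dn_1: "Dn (Suc 0) = dl"
  by (simp add: tns_id)

text \<open>Naturality pushes the middle braiding to the outside, which leaves a separate problem
  for \<open>dl\<close> and one for \<open>Dn n\<close>. It is the step that makes inductions on the
  number of strands work.\<close>

lemma tns_Dn_Suc:
  assumes "src_m f = Suc 0" "src_m g = n" "src_m f' = Suc 0" "src_m g' = n"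
  shows "((f \<otimes>\<^sub>m g) \<otimes>\<^sub>m (f' \<otimes>\<^sub>m g')) \<cdot> Dn (Suc n)
    = (idm (tgt_m f) \<otimes>\<^sub>m br (tgt_m f') (tgt_m g) \<otimes>\<^sub>m idm (tgt_m g')) \<cdot>
      (((f \<otimes>\<^sub>m f') \<cdot> dl) \<otimes>\<^sub>m ((g \<otimes>\<^sub>m g') \<cdot> Dn n))"
proof -
  have "(f \<otimes>\<^sub>m g) \<otimes>\<^sub>m (f' \<otimes>\<^sub>m g') = f \<otimes>\<^sub>m (g \<otimes>\<^sub>m f') \<otimes>\<^sub>m g'"
    by (simp add: tns_assoc)
  then have "((f \<otimes>\<^sub>m g) \<otimes>\<^sub>m (f' \<otimes>\<^sub>m g')) \<cdot> (id1 \<otimes>\<^sub>m br (Suc 0) n \<otimes>\<^sub>m idm n)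
      = f \<otimes>\<^sub>m ((g \<otimes>\<^sub>m f') \<cdot> br (Suc 0) n) \<otimes>\<^sub>m g'"
    using assms by (simp add: tns_cmp)
  also have "\<dots> = f \<otimes>\<^sub>m (br (tgt_m f') (tgt_m g) \<cdot> (f' \<otimes>\<^sub>m g)) \<otimes>\<^sub>m g'"
    using assms by (simp add: br_natural)
  also have "\<dots> = (idm (tgt_m f) \<otimes>\<^sub>m br (tgt_m f') (tgt_m g) \<otimes>\<^sub>m idm (tgt_m g')) \<cdot>
      (f \<otimes>\<^sub>m (f' \<otimes>\<^sub>m g) \<otimes>\<^sub>m g')"
    using assms by (simp add: tns_cmp)
  finally have *: "((f \<otimes>\<^sub>m g) \<otimes>\<^sub>m (f' \<otimes>\<^sub>m g')) \<cdot> (id1 \<otimes>\<^sub>m br (Suc 0) n \<otimes>\<^sub>m idm n) =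
     (idm (tgt_m f) \<otimes>\<^sub>m br (tgt_m f') (tgt_m g) \<otimes>\<^sub>m idm (tgt_m g')) \<cdot>
      ((f \<otimes>\<^sub>m f') \<otimes>\<^sub>m (g \<otimes>\<^sub>m g'))"
    by (simp add: tns_assoc)
  have "((f \<otimes>\<^sub>m g) \<otimes>\<^sub>m (f' \<otimes>\<^sub>m g')) \<cdot> Dn (Suc n)
      = (((f \<otimes>\<^sub>m g) \<otimes>\<^sub>m (f' \<otimes>\<^sub>m g')) \<cdot> (id1 \<otimes>\<^sub>m br (Suc 0) n \<otimes>\<^sub>m idm n)) \<cdot> (dl \<otimes>\<^sub>m Dn n)"
    using assms by (simp add: cmp_assoc)
  also have "\<dots> = (idm (tgt_m f) \<otimes>\<^sub>m br (tgt_m f') (tgt_m g) \<otimes>\<^sub>m idm (tgt_m g')) \<cdot>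
      ((f \<otimes>\<^sub>m f') \<otimes>\<^sub>m (g \<otimes>\<^sub>m g')) \<cdot> (dl \<otimes>\<^sub>m Dn n)"
    unfolding * using assms by (simp add: cmp_assoc)
  also have "((f \<otimes>\<^sub>m f') \<otimes>\<^sub>m (g \<otimes>\<^sub>m g')) \<cdot> (dl \<otimes>\<^sub>m Dn n)
      = ((f \<otimes>\<^sub>m f') \<cdot> dl) \<otimes>\<^sub>m ((g \<otimes>\<^sub>m g') \<cdot> Dn n)"
    using assms by (intro tns_cmp) auto
  finally show ?thesis .
qed

lemma En_Dn:
  "(En n \<otimes>\<^sub>m idm n) \<cdot> Dn n = idm n" "(idm n \<otimes>\<^sub>m En n) \<cdot> Dn n = idm n"
proof (induction n)
  case (Suc n)
  have "(En (Suc n) \<otimes>\<^sub>m idm (Suc n)) \<cdot> Dn (Suc n)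
      = ((ep \<otimes>\<^sub>m En n) \<otimes>\<^sub>m (id1 \<otimes>\<^sub>m idm n)) \<cdot> Dn (Suc n)"
    by (simp add: tns_id)
  also have "\<dots> = idm (Suc n)"
    by (subst tns_Dn_Suc) (simp_all del: Dn.simps add: Suc ep_dl tns_id)
  finally show "(En (Suc n) \<otimes>\<^sub>m idm (Suc n)) \<cdot> Dn (Suc n) = idm (Suc n)" .
  have "(idm (Suc n) \<otimes>\<^sub>m En (Suc n)) \<cdot> Dn (Suc n)
      = ((id1 \<otimes>\<^sub>m idm n) \<otimes>\<^sub>m (ep \<otimes>\<^sub>m En n)) \<cdot> Dn (Suc n)"
    by (simp add: tns_id)
  also have "\<dots> = idm (Suc n)"
    by (subst tns_Dn_Suc) (simp_all del: Dn.simps add: Suc ep_dl tns_id)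
  finally show "(idm (Suc n) \<otimes>\<^sub>m En (Suc n)) \<cdot> Dn (Suc n) = idm (Suc n)" .
qed simp_all

text \<open>Both sides rearrange x x' x'' y y' y'' into x y x' y' x'' y'', each pair of strands
  crossing at most once, so the hexagons suffice and symmetry plays no part in the argument. After
  the outer strands are stripped, both sides become the same product of copies of
  \<open>br (Suc 0) n\<close>.\<close>

lemma br_coassoc_regroup:
  "((id1 \<otimes>\<^sub>m br (Suc 0) n \<otimes>\<^sub>m idm n) \<otimes>\<^sub>m idm (Suc n)) \<cdot> (idm 2 \<otimes>\<^sub>m br (Suc 0) (n + n) \<otimes>\<^sub>m idm n)
   = (idm (Suc n) \<otimes>\<^sub>m (id1 \<otimes>\<^sub>m br (Suc 0) n \<otimes>\<^sub>m idm n)) \<cdot> (id1 \<otimes>\<^sub>m br 2 n \<otimes>\<^sub>m idm (n + n))"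
proof -
  let ?b = "br (Suc 0) n"
  have 1: "(?b \<otimes>\<^sub>m idm (Suc n)) \<cdot> (id1 \<otimes>\<^sub>m br (Suc 0) (n + n))
      = (?b \<otimes>\<^sub>m ?b) \<cdot> (id1 \<otimes>\<^sub>m ?b \<otimes>\<^sub>m idm n)"
  proof -
    have "(?b \<otimes>\<^sub>m idm (Suc n)) \<cdot> (id1 \<otimes>\<^sub>m br (Suc 0) (n + n))
       = (?b \<otimes>\<^sub>m idm (Suc n)) \<cdot> (id1 \<otimes>\<^sub>m (idm n \<otimes>\<^sub>m ?b)) \<cdot> (id1 \<otimes>\<^sub>m ?b \<otimes>\<^sub>m idm n)"
      by (simp add: br_hex1[of "Suc 0" n n] tns_cmp)
    also have "\<dots> = ((?b \<otimes>\<^sub>m idm (Suc n)) \<cdot> (idm (Suc n) \<otimes>\<^sub>m ?b)) \<cdot> (id1 \<otimes>\<^sub>m ?b \<otimes>\<^sub>m idm n)"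
      by (simp add: cmp_assoc tns_id flip: tns_assoc)
    also have "(?b \<otimes>\<^sub>m idm (Suc n)) \<cdot> (idm (Suc n) \<otimes>\<^sub>m ?b) = ?b \<otimes>\<^sub>m ?b"
      by (simp add: tns_cmp)
    finally show ?thesis .
  qed
  have 2: "(idm (Suc n) \<otimes>\<^sub>m ?b) \<cdot> (br 2 n \<otimes>\<^sub>m idm n) = (?b \<otimes>\<^sub>m ?b) \<cdot> (id1 \<otimes>\<^sub>m ?b \<otimes>\<^sub>m idm n)"
  proof -
    have "br 2 n = (?b \<otimes>\<^sub>m id1) \<cdot> (id1 \<otimes>\<^sub>m ?b)"
      using br_hex2[of 1 1 n] by (simp add: numeral_2_eq_2)
    then have "br 2 n \<otimes>\<^sub>m idm n = (?b \<otimes>\<^sub>m id1 \<otimes>\<^sub>m idm n) \<cdot> (id1 \<otimes>\<^sub>m ?b \<otimes>\<^sub>m idm n)"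
      by (simp add: tns_cmp flip: tns_assoc)
    then have "(idm (Suc n) \<otimes>\<^sub>m ?b) \<cdot> (br 2 n \<otimes>\<^sub>m idm n)
      = ((idm (Suc n) \<otimes>\<^sub>m ?b) \<cdot> (?b \<otimes>\<^sub>m idm (Suc n))) \<cdot> (id1 \<otimes>\<^sub>m ?b \<otimes>\<^sub>m idm n)"
      by (simp add: cmp_assoc tns_id)
    also have "(idm (Suc n) \<otimes>\<^sub>m ?b) \<cdot> (?b \<otimes>\<^sub>m idm (Suc n)) = ?b \<otimes>\<^sub>m ?b"
      by (simp add: tns_cmp)
    finally show ?thesis .
  qed
  have "((id1 \<otimes>\<^sub>m ?b \<otimes>\<^sub>m idm n) \<otimes>\<^sub>m idm (Suc n)) \<cdot> (idm 2 \<otimes>\<^sub>m br (Suc 0) (n + n) \<otimes>\<^sub>m idm n)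
     = (id1 \<otimes>\<^sub>m (?b \<otimes>\<^sub>m idm (Suc n)) \<otimes>\<^sub>m idm n) \<cdot> (id1 \<otimes>\<^sub>m (id1 \<otimes>\<^sub>m br (Suc 0) (n + n)) \<otimes>\<^sub>m idm n)"
  proof -
    have "idm 2 = id1 \<otimes>\<^sub>m id1" by (simp add: tns_id numeral_2_eq_2)
    moreover have "idm n \<otimes>\<^sub>m idm (Suc n) = idm (Suc n) \<otimes>\<^sub>m idm n" by (simp add: tns_id)
    ultimately show ?thesis by (simp add: tns_assoc)
  qed
  also have "\<dots> = id1 \<otimes>\<^sub>m ((?b \<otimes>\<^sub>m ?b) \<cdot> (id1 \<otimes>\<^sub>m ?b \<otimes>\<^sub>m idm n)) \<otimes>\<^sub>m idm n"
    by (simp add: tns_cmp flip: 1)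
  also have "\<dots> = (id1 \<otimes>\<^sub>m (idm (Suc n) \<otimes>\<^sub>m ?b) \<otimes>\<^sub>m idm n) \<cdot> (id1 \<otimes>\<^sub>m (br 2 n \<otimes>\<^sub>m idm n) \<otimes>\<^sub>m idm n)"
    by (simp add: tns_cmp flip: 2)
  also have "\<dots> = (idm (Suc n) \<otimes>\<^sub>m (id1 \<otimes>\<^sub>m ?b \<otimes>\<^sub>m idm n)) \<cdot> (id1 \<otimes>\<^sub>m br 2 n \<otimes>\<^sub>m idm (n + n))"
  proof -
    have "id1 \<otimes>\<^sub>m (idm (Suc n) \<otimes>\<^sub>m ?b) \<otimes>\<^sub>m idm n = (id1 \<otimes>\<^sub>m idm (Suc n)) \<otimes>\<^sub>m ?b \<otimes>\<^sub>m idm n"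
      by (simp add: tns_assoc)
    also have "id1 \<otimes>\<^sub>m idm (Suc n) = idm (Suc n) \<otimes>\<^sub>m id1"
      by (simp add: tns_id)
    finally show ?thesis by (simp only: tns_assoc tns_id[of n n, symmetric])
  qed
  finally show ?thesis .
qed

text \<open>Coassociativity of \<open>dl\<close> and of \<open>Dn n\<close> is applied in two
  separate tensor blocks; the braidings left over on the two sides agree by
  \<open>br_coassoc_regroup\<close>.\<close>

lemma Dn_coassoc: "(Dn n \<otimes>\<^sub>m idm n) \<cdot> Dn n = (idm n \<otimes>\<^sub>m Dn n) \<cdot> Dn n"
proof (induction n)
  case (Suc n)
  let ?W = "id1 \<otimes>\<^sub>m br (Suc 0) n \<otimes>\<^sub>m idm n"
  have "(Dn (Suc n) \<otimes>\<^sub>m idm (Suc n)) \<cdot> Dn (Suc n)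
      = (?W \<otimes>\<^sub>m idm (Suc n)) \<cdot> ((dl \<otimes>\<^sub>m Dn n) \<otimes>\<^sub>m (id1 \<otimes>\<^sub>m idm n)) \<cdot> Dn (Suc n)"
  proof -
    have "Dn (Suc n) \<otimes>\<^sub>m idm (Suc n) = (?W \<otimes>\<^sub>m idm (Suc n)) \<cdot> ((dl \<otimes>\<^sub>m Dn n) \<otimes>\<^sub>m (id1 \<otimes>\<^sub>m idm n))"
      by (simp add: tns_cmp tns_id)
    then show ?thesis
      by (simp add: cmp_assoc del: Dn.simps)
  qed
  also have "((dl \<otimes>\<^sub>m Dn n) \<otimes>\<^sub>m (id1 \<otimes>\<^sub>m idm n)) \<cdot> Dn (Suc n)
      = (idm 2 \<otimes>\<^sub>m br (Suc 0) (n + n) \<otimes>\<^sub>m idm n) \<cdot>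
        (((dl \<otimes>\<^sub>m id1) \<cdot> dl) \<otimes>\<^sub>m ((Dn n \<otimes>\<^sub>m idm n) \<cdot> Dn n))"
    by (subst tns_Dn_Suc) simp_all
  also have "(?W \<otimes>\<^sub>m idm (Suc n)) \<cdot> \<dots> =
      ((?W \<otimes>\<^sub>m idm (Suc n)) \<cdot> (idm 2 \<otimes>\<^sub>m br (Suc 0) (n + n) \<otimes>\<^sub>m idm n)) \<cdot>
        (((id1 \<otimes>\<^sub>m dl) \<cdot> dl) \<otimes>\<^sub>m ((idm n \<otimes>\<^sub>m Dn n) \<cdot> Dn n))"
    by (simp add: cmp_assoc dl_coassoc Suc)
  also have "\<dots> = (idm (Suc n) \<otimes>\<^sub>m ?W) \<cdot> (id1 \<otimes>\<^sub>m br 2 n \<otimes>\<^sub>m idm (n + n)) \<cdot>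
        (((id1 \<otimes>\<^sub>m dl) \<cdot> dl) \<otimes>\<^sub>m ((idm n \<otimes>\<^sub>m Dn n) \<cdot> Dn n))"
    unfolding br_coassoc_regroup by (simp add: cmp_assoc)
  also have "(id1 \<otimes>\<^sub>m br 2 n \<otimes>\<^sub>m idm (n + n)) \<cdot>
        (((id1 \<otimes>\<^sub>m dl) \<cdot> dl) \<otimes>\<^sub>m ((idm n \<otimes>\<^sub>m Dn n) \<cdot> Dn n))
      = ((id1 \<otimes>\<^sub>m idm n) \<otimes>\<^sub>m (dl \<otimes>\<^sub>m Dn n)) \<cdot> Dn (Suc n)"
    by (subst tns_Dn_Suc) simp_all
  also have "(idm (Suc n) \<otimes>\<^sub>m ?W) \<cdot> \<dots> = (idm (Suc n) \<otimes>\<^sub>m Dn (Suc n)) \<cdot> Dn (Suc n)"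
  proof -
    have "idm (Suc n) \<otimes>\<^sub>m Dn (Suc n) = (idm (Suc n) \<otimes>\<^sub>m ?W) \<cdot> ((id1 \<otimes>\<^sub>m idm n) \<otimes>\<^sub>m (dl \<otimes>\<^sub>m Dn n))"
      by (simp add: tns_cmp tns_id)
    then show ?thesis
      by (simp add: cmp_assoc del: Dn.simps)
  qed
  finally show ?case .
qed simp

text \<open>On the left the second copy of the first strand passes the block of \<open>n\<close>
  strands and is then brought back across it. Untangling this double crossing takes true symmetry of
  the braiding, not just the hexagons.\<close>

lemma br_Suc_Suc_regroup:
  "br (Suc n) (Suc n) \<cdot> (id1 \<otimes>\<^sub>m br (Suc 0) n \<otimes>\<^sub>m idm n)
   = (id1 \<otimes>\<^sub>m br (Suc 0) n \<otimes>\<^sub>m idm n) \<cdot> (tau \<otimes>\<^sub>m br n n)"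
proof -
  let ?b = "br (Suc 0) n"
  \<comment> \<open>The double crossing is isolated here and removed by
    \<open>br_1_symmetric\<close>.\<close>
  have 1: "br n (Suc n) \<cdot> (?b \<otimes>\<^sub>m idm n) = id1 \<otimes>\<^sub>m br n n"
  proof -
    have "br n (Suc n) = (id1 \<otimes>\<^sub>m br n n) \<cdot> (br n (Suc 0) \<otimes>\<^sub>m idm n)"
      using br_hex1[of n 1 n] by simp
    then have "br n (Suc n) \<cdot> (?b \<otimes>\<^sub>m idm n)
        = (id1 \<otimes>\<^sub>m br n n) \<cdot> ((br n (Suc 0) \<otimes>\<^sub>m idm n) \<cdot> (?b \<otimes>\<^sub>m idm n))"
      by (simp add: cmp_assoc)
    also have "(br n (Suc 0) \<otimes>\<^sub>m idm n) \<cdot> (?b \<otimes>\<^sub>m idm n) = idm (Suc n + n)"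
      by (simp add: tns_cmp br_1_symmetric tns_id)
    finally show ?thesis by simp
  qed
  have "br (Suc n) (Suc n) = (br (Suc 0) (Suc n) \<otimes>\<^sub>m idm n) \<cdot> (id1 \<otimes>\<^sub>m br n (Suc n))"
    using br_hex2[of 1 n "Suc n"] by simp
  then have "br (Suc n) (Suc n) \<cdot> (id1 \<otimes>\<^sub>m ?b \<otimes>\<^sub>m idm n)
      = (br (Suc 0) (Suc n) \<otimes>\<^sub>m idm n) \<cdot> (id1 \<otimes>\<^sub>m br n (Suc n)) \<cdot> (id1 \<otimes>\<^sub>m ?b \<otimes>\<^sub>m idm n)"
    by (simp add: cmp_assoc)
  also have "(id1 \<otimes>\<^sub>m br n (Suc n)) \<cdot> (id1 \<otimes>\<^sub>m ?b \<otimes>\<^sub>m idm n) = id1 \<otimes>\<^sub>m id1 \<otimes>\<^sub>m br n n"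
    by (simp add: tns_cmp 1)
  also have "br (Suc 0) (Suc n) = (id1 \<otimes>\<^sub>m ?b) \<cdot> (tau \<otimes>\<^sub>m idm n)"
    using br_hex1[of 1 1 n] by simp
  also have "((id1 \<otimes>\<^sub>m ?b) \<cdot> (tau \<otimes>\<^sub>m idm n)) \<otimes>\<^sub>m idm n
      = (id1 \<otimes>\<^sub>m ?b \<otimes>\<^sub>m idm n) \<cdot> (tau \<otimes>\<^sub>m idm (n + n))"
  proof -
    have "((id1 \<otimes>\<^sub>m ?b) \<cdot> (tau \<otimes>\<^sub>m idm n)) \<otimes>\<^sub>m idm n
        = ((id1 \<otimes>\<^sub>m ?b) \<otimes>\<^sub>m idm n) \<cdot> ((tau \<otimes>\<^sub>m idm n) \<otimes>\<^sub>m idm n)"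
      by (simp add: tns_cmp)
    then show ?thesis
      by (simp add: tns_assoc tns_id)
  qed
  also have "(\<dots>) \<cdot> (id1 \<otimes>\<^sub>m id1 \<otimes>\<^sub>m br n n)
      = (id1 \<otimes>\<^sub>m ?b \<otimes>\<^sub>m idm n) \<cdot> (tau \<otimes>\<^sub>m idm (n + n)) \<cdot> ((id1 \<otimes>\<^sub>m id1) \<otimes>\<^sub>m br n n)"
    by (simp add: cmp_assoc tns_assoc)
  also have "(tau \<otimes>\<^sub>m idm (n + n)) \<cdot> ((id1 \<otimes>\<^sub>m id1) \<otimes>\<^sub>m br n n) = tau \<otimes>\<^sub>m br n n"
    by (simp add: tns_cmp tns_id)
  finally show ?thesis .
qed

lemma br_Dn: "br n n \<cdot> Dn n = Dn n"
proof (induction n)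
  case (Suc n)
  let ?W = "id1 \<otimes>\<^sub>m br (Suc 0) n \<otimes>\<^sub>m idm n"
  have "br (Suc n) (Suc n) \<cdot> Dn (Suc n) = (br (Suc n) (Suc n) \<cdot> ?W) \<cdot> (dl \<otimes>\<^sub>m Dn n)"
    by (simp add: cmp_assoc)
  also have "\<dots> = ?W \<cdot> (tau \<otimes>\<^sub>m br n n) \<cdot> (dl \<otimes>\<^sub>m Dn n)"
    unfolding br_Suc_Suc_regroup by (simp add: cmp_assoc)
  also have "\<dots> = Dn (Suc n)"
    by (simp add: tns_cmp tau_dl Suc)
  finally show ?case .
qed simp

text \<open>In Sweedler notation, the second and third of four copies may be exchanged.
  Coassociativity rebrackets the fourfold comultiplication so that one \<open>Dn n\<close> produces
  exactly these two copies, and \<open>br_Dn\<close> absorbs the braiding.\<close>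

lemma Dn_middle_swap:
  "(idm n \<otimes>\<^sub>m br n n \<otimes>\<^sub>m idm n) \<cdot> (Dn n \<otimes>\<^sub>m Dn n) \<cdot> Dn n = (Dn n \<otimes>\<^sub>m Dn n) \<cdot> Dn n"
proof -
  have "(Dn n \<otimes>\<^sub>m Dn n) \<cdot> Dn n = (Dn n \<otimes>\<^sub>m idm (n + n)) \<cdot> (idm n \<otimes>\<^sub>m Dn n) \<cdot> Dn n"
    by (simp add: tns_cmp flip: cmp_assoc)
  also have "\<dots> = (Dn n \<otimes>\<^sub>m idm (n + n)) \<cdot> (Dn n \<otimes>\<^sub>m idm n) \<cdot> Dn n"
    by (simp add: Dn_coassoc)
  also have "\<dots> = (((Dn n \<otimes>\<^sub>m idm n) \<otimes>\<^sub>m idm n) \<cdot> (Dn n \<otimes>\<^sub>m idm n)) \<cdot> Dn n"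
    by (simp add: cmp_assoc tns_assoc tns_id)
  also have "((Dn n \<otimes>\<^sub>m idm n) \<otimes>\<^sub>m idm n) \<cdot> (Dn n \<otimes>\<^sub>m idm n)
      = ((idm n \<otimes>\<^sub>m Dn n) \<cdot> Dn n) \<otimes>\<^sub>m idm n"
    by (simp add: tns_cmp Dn_coassoc)
  also have "\<dots> = (idm n \<otimes>\<^sub>m Dn n \<otimes>\<^sub>m idm n) \<cdot> (Dn n \<otimes>\<^sub>m idm n)"
    by (simp add: tns_cmp flip: tns_assoc)
  also have "(\<dots>) \<cdot> Dn n = (idm n \<otimes>\<^sub>m Dn n \<otimes>\<^sub>m idm n) \<cdot> (Dn n \<otimes>\<^sub>m idm n) \<cdot> Dn n"
    by (simp add: cmp_assoc)
  finally have *: "(Dn n \<otimes>\<^sub>m Dn n) \<cdot> Dn n = \<dots>" .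
  have "(idm n \<otimes>\<^sub>m br n n \<otimes>\<^sub>m idm n) \<cdot> (idm n \<otimes>\<^sub>m Dn n \<otimes>\<^sub>m idm n) = idm n \<otimes>\<^sub>m Dn n \<otimes>\<^sub>m idm n"
    by (simp add: tns_cmp br_Dn)
  then show ?thesis
    unfolding * by (simp flip: cmp_assoc)
qed

section \<open>The abelian group of coalgebra morphisms to the generating object\<close>

lemma middle_swap_natural:
  assumes "src_m f = l" "src_m f' = l'" "src_m g = l''" "src_m g' = l'''"
    "tgt_m f = a" "tgt_m f' = a'" "tgt_m g = a''" "tgt_m g' = a'''"
  shows "(idm a \<otimes>\<^sub>m br a' a'' \<otimes>\<^sub>m idm a''') \<cdot> ((f \<otimes>\<^sub>m f') \<otimes>\<^sub>m (g \<otimes>\<^sub>m g'))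
    = ((f \<otimes>\<^sub>m g) \<otimes>\<^sub>m (f' \<otimes>\<^sub>m g')) \<cdot> (idm l \<otimes>\<^sub>m br l' l'' \<otimes>\<^sub>m idm l''')"
proof -
  have "(f \<otimes>\<^sub>m f') \<otimes>\<^sub>m (g \<otimes>\<^sub>m g') = f \<otimes>\<^sub>m (f' \<otimes>\<^sub>m g) \<otimes>\<^sub>m g'"
    "(f \<otimes>\<^sub>m g) \<otimes>\<^sub>m (f' \<otimes>\<^sub>m g') = f \<otimes>\<^sub>m (g \<otimes>\<^sub>m f') \<otimes>\<^sub>m g'"
    by (simp_all add: tns_assoc)
  then show ?thesis
    using assms by (simp add: tns_cmp br_natural)
qed

text \<open>The multiplication \<open>M\<close> is a parameter because two algebras occur as
  targets: the generating object with \<open>mu\<close>, and its tensor square with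
  \<open>mu2\<close>, where the convolution inverses of \<open>dl\<close> are compared.\<close>

definition conv :: "mor \<Rightarrow> nat \<Rightarrow> mor \<Rightarrow> mor \<Rightarrow> mor" where
  "conv M l f g = M \<cdot> (f \<otimes>\<^sub>m g) \<cdot> Dn l"

lemma conv_assoc:
  assumes M: "src_m M = a + a" "tgt_m M = a" "M \<cdot> (M \<otimes>\<^sub>m idm a) = M \<cdot> (idm a \<otimes>\<^sub>m M)"
    and l: "src_m f = l" "src_m g = l" "src_m h = l"
    and a: "tgt_m f = a" "tgt_m g = a" "tgt_m h = a"
  shows "conv M l (conv M l f g) h = conv M l f (conv M l g h)"
proof -
  note [simp] = M(1,2) l a
  have 1: "(M \<cdot> (f \<otimes>\<^sub>m g) \<cdot> Dn l) \<otimes>\<^sub>m h = (M \<otimes>\<^sub>m idm a) \<cdot> ((f \<otimes>\<^sub>m g) \<otimes>\<^sub>m h) \<cdot> (Dn l \<otimes>\<^sub>m idm l)"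
    by (simp add: tns_cmp)
  have 2: "f \<otimes>\<^sub>m (M \<cdot> (g \<otimes>\<^sub>m h) \<cdot> Dn l) = (idm a \<otimes>\<^sub>m M) \<cdot> (f \<otimes>\<^sub>m (g \<otimes>\<^sub>m h)) \<cdot> (idm l \<otimes>\<^sub>m Dn l)"
    by (simp add: tns_cmp)
  have "conv M l (conv M l f g) h
      = (M \<cdot> (M \<otimes>\<^sub>m idm a)) \<cdot> ((f \<otimes>\<^sub>m g) \<otimes>\<^sub>m h) \<cdot> (Dn l \<otimes>\<^sub>m idm l) \<cdot> Dn l"
    unfolding conv_def 1 by (simp add: cmp_assoc)
  also have "\<dots> = (M \<cdot> (idm a \<otimes>\<^sub>m M)) \<cdot> (f \<otimes>\<^sub>m (g \<otimes>\<^sub>m h)) \<cdot> (idm l \<otimes>\<^sub>m Dn l) \<cdot> Dn l"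
    by (simp only: M(3) Dn_coassoc tns_assoc)
  also have "\<dots> = conv M l f (conv M l g h)"
    unfolding conv_def 2 by (simp add: cmp_assoc)
  finally show ?thesis .
qed

lemma conv_unitL:
  assumes "src_m M = a + a" "tgt_m M = a" "src_m e = 0" "tgt_m e = a" "M \<cdot> (e \<otimes>\<^sub>m idm a) = idm a"
    and "src_m f = l" "tgt_m f = a"
  shows "conv M l (e \<cdot> En l) f = f"
proof -
  note [simp] = assms(1-4,6,7)
  have "(e \<cdot> En l) \<otimes>\<^sub>m f = (e \<otimes>\<^sub>m idm a) \<cdot> f \<cdot> (En l \<otimes>\<^sub>m idm l)"
    using tns_cmp[of "idm 0" "En l" f "idm l"] tns_cmp[of e "En l" "idm a" f] by simp
  then have "conv M l (e \<cdot> En l) f = (M \<cdot> (e \<otimes>\<^sub>m idm a)) \<cdot> f \<cdot> (En l \<otimes>\<^sub>m idm l) \<cdot> Dn l"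
    unfolding conv_def by (simp add: cmp_assoc)
  then show ?thesis
    by (simp add: assms(5) En_Dn)
qed

lemma conv_unitR:
  assumes "src_m M = a + a" "tgt_m M = a" "src_m e = 0" "tgt_m e = a" "M \<cdot> (idm a \<otimes>\<^sub>m e) = idm a"
    and "src_m f = l" "tgt_m f = a"
  shows "conv M l f (e \<cdot> En l) = f"
proof -
  note [simp] = assms(1-4,6,7)
  have "f \<otimes>\<^sub>m (e \<cdot> En l) = (idm a \<otimes>\<^sub>m e) \<cdot> f \<cdot> (idm l \<otimes>\<^sub>m En l)"
    using tns_cmp[of f "idm l" "idm 0" "En l"] tns_cmp[of "idm a" f e "En l"] by simp
  then have "conv M l f (e \<cdot> En l) = (M \<cdot> (idm a \<otimes>\<^sub>m e)) \<cdot> f \<cdot> (idm l \<otimes>\<^sub>m En l) \<cdot> Dn l"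
    unfolding conv_def by (simp add: cmp_assoc)
  then show ?thesis
    by (simp add: assms(5) En_Dn)
qed

text \<open>The product of the tensor square algebra, sending a b and c d to ac and bd. In terms of
  it the bialgebra relation says that \<open>dl\<close> is multiplicative, which is
  \<open>dl_mu2\<close>.\<close>

definition mu2 :: mor where
  "mu2 = (mu \<otimes>\<^sub>m mu) \<cdot> (id1 \<otimes>\<^sub>m tau \<otimes>\<^sub>m id1)"

lemma mu2_typed [simp]: "src_m mu2 = 4" "tgt_m mu2 = 2"
  by (simp_all add: mu2_def)

lemma dl_mu2: "dl \<cdot> mu = mu2 \<cdot> (dl \<otimes>\<^sub>m dl)"
  by (simp add: dl_mu mu2_def cmp_assoc)

lemma mu2_un2: "mu2 \<cdot> ((un \<otimes>\<^sub>m un) \<otimes>\<^sub>m idm 2) = idm 2" "mu2 \<cdot> (idm 2 \<otimes>\<^sub>m (un \<otimes>\<^sub>m un)) = idm 2"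
proof -
  have i2: "idm 2 = id1 \<otimes>\<^sub>m id1" by (simp add: tns_id numeral_2_eq_2)
  have "mu2 \<cdot> ((un \<otimes>\<^sub>m un) \<otimes>\<^sub>m idm 2) = (mu \<otimes>\<^sub>m mu) \<cdot> ((un \<otimes>\<^sub>m id1) \<otimes>\<^sub>m (un \<otimes>\<^sub>m id1))"
  proof -
    have "(id1 \<otimes>\<^sub>m tau \<otimes>\<^sub>m id1) \<cdot> ((un \<otimes>\<^sub>m un) \<otimes>\<^sub>m (id1 \<otimes>\<^sub>m id1)) = (un \<otimes>\<^sub>m id1) \<otimes>\<^sub>m (un \<otimes>\<^sub>m id1)"
      using middle_swap_natural[OF refl refl refl refl refl refl refl refl, of un un id1 id1]
      by (simp add: tns_id)
    then show ?thesis unfolding mu2_def i2 by (simp add: cmp_assoc)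
  qed
  then show "mu2 \<cdot> ((un \<otimes>\<^sub>m un) \<otimes>\<^sub>m idm 2) = idm 2"
    by (simp add: tns_cmp mu_un i2)
  have "mu2 \<cdot> (idm 2 \<otimes>\<^sub>m (un \<otimes>\<^sub>m un)) = (mu \<otimes>\<^sub>m mu) \<cdot> ((id1 \<otimes>\<^sub>m un) \<otimes>\<^sub>m (id1 \<otimes>\<^sub>m un))"
  proof -
    have "(id1 \<otimes>\<^sub>m tau \<otimes>\<^sub>m id1) \<cdot> ((id1 \<otimes>\<^sub>m id1) \<otimes>\<^sub>m (un \<otimes>\<^sub>m un)) = (id1 \<otimes>\<^sub>m un) \<otimes>\<^sub>m (id1 \<otimes>\<^sub>m un)"
      using middle_swap_natural[OF refl refl refl refl refl refl refl refl, of id1 id1 un un]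
      by (simp add: tns_id)
    then show ?thesis unfolding mu2_def i2 by (simp add: cmp_assoc)
  qed
  then show "mu2 \<cdot> (idm 2 \<otimes>\<^sub>m (un \<otimes>\<^sub>m un)) = idm 2"
    by (simp add: tns_cmp mu_un i2)
qed

text \<open>Naturality moves all products to the left, where associativity of \<open>mu\<close>
  applies in each tensor factor. What remains are two ways of sorting the strands x1 y1 x2 y2 x3 y3
  into x1 x2 x3 y1 y2 y3; both reduce to \<open>tau\<close> on two disjoint pairs followed by
  \<open>tau\<close> in the middle.\<close>

lemma mu2_assoc: "mu2 \<cdot> (mu2 \<otimes>\<^sub>m idm 2) = mu2 \<cdot> (idm 2 \<otimes>\<^sub>m mu2)"
proof -
  let ?W = "id1 \<otimes>\<^sub>m tau \<otimes>\<^sub>m id1"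
  have i2: "idm 2 = id1 \<otimes>\<^sub>m id1" by (simp add: tns_id numeral_2_eq_2)
  have br21: "br 2 (Suc 0) = (tau \<otimes>\<^sub>m id1) \<cdot> (id1 \<otimes>\<^sub>m tau)"
    using br_hex2[of 1 1 1] by (simp add: numeral_2_eq_2)
  have br12: "br (Suc 0) 2 = (id1 \<otimes>\<^sub>m tau) \<cdot> (tau \<otimes>\<^sub>m id1)"
    using br_hex1[of 1 1 1] by (simp add: numeral_2_eq_2)
  have L: "mu2 \<cdot> (mu2 \<otimes>\<^sub>m idm 2) =
     ((mu \<cdot> (mu \<otimes>\<^sub>m id1)) \<otimes>\<^sub>m (mu \<cdot> (mu \<otimes>\<^sub>m id1))) \<cdot> (idm 2 \<otimes>\<^sub>m br 2 (Suc 0) \<otimes>\<^sub>m id1) \<cdot> (?W \<otimes>\<^sub>m idm 2)"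
  proof -
    have "mu2 \<otimes>\<^sub>m idm 2 = ((mu \<otimes>\<^sub>m mu) \<otimes>\<^sub>m (id1 \<otimes>\<^sub>m id1)) \<cdot> (?W \<otimes>\<^sub>m idm 2)"
      by (simp add: mu2_def tns_cmp tns_id numeral_2_eq_2)
    then have "mu2 \<cdot> (mu2 \<otimes>\<^sub>m idm 2) =
        (mu \<otimes>\<^sub>m mu) \<cdot> (?W \<cdot> ((mu \<otimes>\<^sub>m mu) \<otimes>\<^sub>m (id1 \<otimes>\<^sub>m id1))) \<cdot> (?W \<otimes>\<^sub>m idm 2)"
      by (simp add: mu2_def cmp_assoc)
    also have "?W \<cdot> ((mu \<otimes>\<^sub>m mu) \<otimes>\<^sub>m (id1 \<otimes>\<^sub>m id1))
       = ((mu \<otimes>\<^sub>m id1) \<otimes>\<^sub>m (mu \<otimes>\<^sub>m id1)) \<cdot> (idm 2 \<otimes>\<^sub>m br 2 (Suc 0) \<otimes>\<^sub>m id1)"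
      by (simp add: middle_swap_natural)
    finally show ?thesis by (simp add: tns_cmp flip: cmp_assoc)
  qed
  have R: "mu2 \<cdot> (idm 2 \<otimes>\<^sub>m mu2) =
     ((mu \<cdot> (id1 \<otimes>\<^sub>m mu)) \<otimes>\<^sub>m (mu \<cdot> (id1 \<otimes>\<^sub>m mu))) \<cdot> (id1 \<otimes>\<^sub>m br (Suc 0) 2 \<otimes>\<^sub>m idm 2) \<cdot> (idm 2 \<otimes>\<^sub>m ?W)"
  proof -
    have "idm 2 \<otimes>\<^sub>m mu2 = ((id1 \<otimes>\<^sub>m id1) \<otimes>\<^sub>m (mu \<otimes>\<^sub>m mu)) \<cdot> (idm 2 \<otimes>\<^sub>m ?W)"
      by (simp add: mu2_def tns_cmp tns_id numeral_2_eq_2)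
    then have "mu2 \<cdot> (idm 2 \<otimes>\<^sub>m mu2) =
        (mu \<otimes>\<^sub>m mu) \<cdot> (?W \<cdot> ((id1 \<otimes>\<^sub>m id1) \<otimes>\<^sub>m (mu \<otimes>\<^sub>m mu))) \<cdot> (idm 2 \<otimes>\<^sub>m ?W)"
      by (simp add: mu2_def cmp_assoc)
    also have "?W \<cdot> ((id1 \<otimes>\<^sub>m id1) \<otimes>\<^sub>m (mu \<otimes>\<^sub>m mu))
       = ((id1 \<otimes>\<^sub>m mu) \<otimes>\<^sub>m (id1 \<otimes>\<^sub>m mu)) \<cdot> (id1 \<otimes>\<^sub>m br (Suc 0) 2 \<otimes>\<^sub>m idm 2)"
      by (simp add: middle_swap_natural)
    finally show ?thesis by (simp add: tns_cmp flip: cmp_assoc)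
  qed
  have 1: "(id1 \<otimes>\<^sub>m br 2 (Suc 0)) \<cdot> (tau \<otimes>\<^sub>m idm 2) = (id1 \<otimes>\<^sub>m tau \<otimes>\<^sub>m id1) \<cdot> (tau \<otimes>\<^sub>m tau)"
  proof -
    have "id1 \<otimes>\<^sub>m br 2 (Suc 0) = (id1 \<otimes>\<^sub>m tau \<otimes>\<^sub>m id1) \<cdot> (idm 2 \<otimes>\<^sub>m tau)"
      by (simp add: br21 i2 tns_cmp tns_assoc)
    then show ?thesis by (simp add: cmp_assoc tns_cmp)
  qed
  have 2: "(br (Suc 0) 2 \<otimes>\<^sub>m id1) \<cdot> (idm 2 \<otimes>\<^sub>m tau) = (id1 \<otimes>\<^sub>m tau \<otimes>\<^sub>m id1) \<cdot> (tau \<otimes>\<^sub>m tau)"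
  proof -
    have "((id1 \<otimes>\<^sub>m tau) \<cdot> (tau \<otimes>\<^sub>m id1)) \<otimes>\<^sub>m id1 = ((id1 \<otimes>\<^sub>m tau) \<otimes>\<^sub>m id1) \<cdot> ((tau \<otimes>\<^sub>m id1) \<otimes>\<^sub>m id1)"
      by (simp add: tns_cmp)
    then have "br (Suc 0) 2 \<otimes>\<^sub>m id1 = (id1 \<otimes>\<^sub>m tau \<otimes>\<^sub>m id1) \<cdot> (tau \<otimes>\<^sub>m idm 2)"
      by (simp add: br12 i2 tns_assoc)
    then show ?thesis by (simp add: cmp_assoc tns_cmp)
  qed
  have "(idm 2 \<otimes>\<^sub>m br 2 (Suc 0) \<otimes>\<^sub>m id1) \<cdot> (?W \<otimes>\<^sub>m idm 2)
     = (id1 \<otimes>\<^sub>m (id1 \<otimes>\<^sub>m br 2 (Suc 0)) \<otimes>\<^sub>m id1) \<cdot> (id1 \<otimes>\<^sub>m (tau \<otimes>\<^sub>m idm 2) \<otimes>\<^sub>m id1)"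
    by (simp only: i2 tns_assoc)
  also have "\<dots> = (id1 \<otimes>\<^sub>m (br (Suc 0) 2 \<otimes>\<^sub>m id1) \<otimes>\<^sub>m id1) \<cdot> (id1 \<otimes>\<^sub>m (idm 2 \<otimes>\<^sub>m tau) \<otimes>\<^sub>m id1)"
    by (simp add: tns_cmp 1 2)
  also have "\<dots> = (id1 \<otimes>\<^sub>m br (Suc 0) 2 \<otimes>\<^sub>m idm 2) \<cdot> (idm 2 \<otimes>\<^sub>m ?W)"
    by (simp only: i2 tns_assoc)
  finally show ?thesis
    unfolding L R mu_assoc by simp
qed

text \<open>For \<open>l = 0\<close> these are the group-like elements of the Hopf monoid; in
  general they are group-like elements depending on \<open>l\<close> inputs.\<close>

definition coalg_mor :: "nat \<Rightarrow> mor \<Rightarrow> bool" where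
  "coalg_mor l h \<longleftrightarrow> src_m h = l \<and> tgt_m h = Suc 0 \<and> ep \<cdot> h = En l \<and> dl \<cdot> h = (h \<otimes>\<^sub>m h) \<cdot> Dn l"

lemma coalg_morD:
  assumes "coalg_mor l h"
  shows "src_m h = l" "tgt_m h = Suc 0" "ep \<cdot> h = En l" "dl \<cdot> h = (h \<otimes>\<^sub>m h) \<cdot> Dn l"
  using assms by (auto simp: coalg_mor_def)

lemma En_En_Dn: "(En l \<otimes>\<^sub>m En l) \<cdot> Dn l = En l"
proof -
  have "En l \<otimes>\<^sub>m En l = (idm 0 \<otimes>\<^sub>m En l) \<cdot> (En l \<otimes>\<^sub>m idm l)"
    by (simp only: tns_cmp src_En tgt_En src_tgt_simps cmp_idL cmp_idR)
  then have "(En l \<otimes>\<^sub>m En l) \<cdot> Dn l = En l \<cdot> (En l \<otimes>\<^sub>m idm l) \<cdot> Dn l"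
    by (simp add: cmp_assoc)
  then show ?thesis
    by (simp add: En_Dn)
qed

lemma ep_ep_dl: "(ep \<otimes>\<^sub>m ep) \<cdot> dl = ep"
  using En_En_Dn[of "Suc 0"] by (simp add: tns_id)

lemma coalg_mor_unit: "coalg_mor l (un \<cdot> En l)"
proof -
  have "(un \<cdot> En l) \<otimes>\<^sub>m (un \<cdot> En l) = (un \<otimes>\<^sub>m un) \<cdot> (En l \<otimes>\<^sub>m En l)"
    by (simp add: tns_cmp)
  then have "((un \<cdot> En l) \<otimes>\<^sub>m (un \<cdot> En l)) \<cdot> Dn l = (un \<otimes>\<^sub>m un) \<cdot> En l"
    by (simp add: cmp_assoc En_En_Dn)
  moreover have "dl \<cdot> un \<cdot> En l = (un \<otimes>\<^sub>m un) \<cdot> En l"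
    by (simp add: dl_un flip: cmp_assoc)
  moreover have "ep \<cdot> un \<cdot> En l = En l"
    by (simp add: ep_un flip: cmp_assoc)
  ultimately show ?thesis
    by (simp add: coalg_mor_def)
qed

text \<open>Comultiplying a product gives f(x1) g(x3) in one factor and f(x2) g(x4) in the other,
  while the tensor square of the convolution has x2 and x3 exchanged. Cocommutativity, through
  \<open>Dn_middle_swap\<close>, identifies the two.\<close>

lemma coalg_mor_conv:
  assumes "coalg_mor l f" "coalg_mor l g"
  shows "coalg_mor l (conv mu l f g)"
proof -
  note f [simp] = coalg_morD(1,2)[OF assms(1)] and g [simp] = coalg_morD(1,2)[OF assms(2)]
  have "ep \<cdot> conv mu l f g = (ep \<cdot> mu) \<cdot> (f \<otimes>\<^sub>m g) \<cdot> Dn l"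
    by (simp add: conv_def cmp_assoc)
  also have "\<dots> = ((ep \<otimes>\<^sub>m ep) \<cdot> (f \<otimes>\<^sub>m g)) \<cdot> Dn l"
    by (simp add: ep_mu cmp_assoc)
  also have "\<dots> = En l"
    using assms by (simp add: tns_cmp coalg_morD En_En_Dn)
  finally have e: "ep \<cdot> conv mu l f g = En l" .
  let ?DDD = "(Dn l \<otimes>\<^sub>m Dn l) \<cdot> Dn l"
  have "dl \<cdot> conv mu l f g = (dl \<cdot> mu) \<cdot> (f \<otimes>\<^sub>m g) \<cdot> Dn l"
    by (simp add: conv_def cmp_assoc)
  also have "\<dots> = mu2 \<cdot> ((dl \<otimes>\<^sub>m dl) \<cdot> (f \<otimes>\<^sub>m g)) \<cdot> Dn l"
    by (simp add: dl_mu2 cmp_assoc)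
  also have "(dl \<otimes>\<^sub>m dl) \<cdot> (f \<otimes>\<^sub>m g) = ((f \<otimes>\<^sub>m f) \<otimes>\<^sub>m (g \<otimes>\<^sub>m g)) \<cdot> (Dn l \<otimes>\<^sub>m Dn l)"
    using assms by (simp add: tns_cmp coalg_morD)
  also have "mu2 \<cdot> (\<dots>) \<cdot> Dn l
      = (mu \<otimes>\<^sub>m mu) \<cdot> ((id1 \<otimes>\<^sub>m tau \<otimes>\<^sub>m id1) \<cdot> ((f \<otimes>\<^sub>m f) \<otimes>\<^sub>m (g \<otimes>\<^sub>m g))) \<cdot> ?DDD"
    by (simp add: mu2_def cmp_assoc)
  also have "(id1 \<otimes>\<^sub>m tau \<otimes>\<^sub>m id1) \<cdot> ((f \<otimes>\<^sub>m f) \<otimes>\<^sub>m (g \<otimes>\<^sub>m g))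
      = ((f \<otimes>\<^sub>m g) \<otimes>\<^sub>m (f \<otimes>\<^sub>m g)) \<cdot> (idm l \<otimes>\<^sub>m br l l \<otimes>\<^sub>m idm l)"
    by (rule middle_swap_natural) simp_all
  also have "(mu \<otimes>\<^sub>m mu) \<cdot> (\<dots>) \<cdot> ?DDD
      = (mu \<otimes>\<^sub>m mu) \<cdot> ((f \<otimes>\<^sub>m g) \<otimes>\<^sub>m (f \<otimes>\<^sub>m g)) \<cdot> (idm l \<otimes>\<^sub>m br l l \<otimes>\<^sub>m idm l) \<cdot> ?DDD"
    by (simp add: cmp_assoc)
  also have "(idm l \<otimes>\<^sub>m br l l \<otimes>\<^sub>m idm l) \<cdot> ?DDD = ?DDD"
    by (rule Dn_middle_swap)
  also have "(mu \<otimes>\<^sub>m mu) \<cdot> ((f \<otimes>\<^sub>m g) \<otimes>\<^sub>m (f \<otimes>\<^sub>m g)) \<cdot> ?DDD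
      = (conv mu l f g \<otimes>\<^sub>m conv mu l f g) \<cdot> Dn l"
    by (simp add: conv_def tns_cmp flip: cmp_assoc)
  finally show ?thesis
    using e by (simp add: coalg_mor_def) (simp add: conv_def)
qed

text \<open>The counit of S(x) equals the counit of S(x1) times that of x2, by counitality; since
  the counit is multiplicative this is the counit of S(x1) x2, to which the antipode relation
  applies.\<close>

lemma ep_an: "ep \<cdot> an = ep"
proof -
  have "ep \<cdot> an = (ep \<cdot> an) \<cdot> (id1 \<otimes>\<^sub>m ep) \<cdot> dl"
    by (simp add: ep_dl)
  also have "\<dots> = (((ep \<cdot> an) \<otimes>\<^sub>m idm 0) \<cdot> (id1 \<otimes>\<^sub>m ep)) \<cdot> dl"
    by (simp add: cmp_assoc)
  also have "((ep \<cdot> an) \<otimes>\<^sub>m idm 0) \<cdot> (id1 \<otimes>\<^sub>m ep) = (ep \<otimes>\<^sub>m ep) \<cdot> (an \<otimes>\<^sub>m id1)"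
    by (simp only: tns_cmp src_tgt_simps src_cmp tgt_cmp gsrc.simps gtgt.simps cmp_idL cmp_idR)
  also have "(\<dots>) \<cdot> dl = ep \<cdot> mu \<cdot> (an \<otimes>\<^sub>m id1) \<cdot> dl"
    by (simp add: cmp_assoc flip: ep_mu)
  also have "\<dots> = ep"
    by (simp add: antipode ep_un flip: cmp_assoc)
  finally show ?thesis .
qed

text \<open>Both sides are convolution inverses of the comultiplication.\<close>
lemma dl_an: "dl \<cdot> an = (an \<otimes>\<^sub>m an) \<cdot> dl"
proof -
  let ?e = "(un \<otimes>\<^sub>m un) \<cdot> En (Suc 0)"
  let ?c = "conv mu2 (Suc 0)"
  have 1: "?c (dl \<cdot> an) dl = ?e"
  proof -
    have "(dl \<cdot> an) \<otimes>\<^sub>m dl = (dl \<otimes>\<^sub>m dl) \<cdot> (an \<otimes>\<^sub>m id1)"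
      by (simp add: tns_cmp)
    then have "?c (dl \<cdot> an) dl = (mu2 \<cdot> (dl \<otimes>\<^sub>m dl)) \<cdot> (an \<otimes>\<^sub>m id1) \<cdot> dl"
      unfolding conv_def Dn_1 by (simp add: cmp_assoc)
    also have "\<dots> = dl \<cdot> mu \<cdot> (an \<otimes>\<^sub>m id1) \<cdot> dl"
      by (simp add: cmp_assoc flip: dl_mu2)
    also have "\<dots> = ?e"
      unfolding antipode by (simp add: dl_un flip: cmp_assoc)
    finally show ?thesis .
  qed
  have 2: "?c dl ((an \<otimes>\<^sub>m an) \<cdot> dl) = ?e"
  proof -
    have "dl \<otimes>\<^sub>m ((an \<otimes>\<^sub>m an) \<cdot> dl) = ((id1 \<otimes>\<^sub>m id1) \<otimes>\<^sub>m (an \<otimes>\<^sub>m an)) \<cdot> (dl \<otimes>\<^sub>m dl)"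
      by (simp add: tns_cmp tns_id)
    then have "?c dl ((an \<otimes>\<^sub>m an) \<cdot> dl)
        = (mu \<otimes>\<^sub>m mu) \<cdot> ((id1 \<otimes>\<^sub>m tau \<otimes>\<^sub>m id1) \<cdot> ((id1 \<otimes>\<^sub>m id1) \<otimes>\<^sub>m (an \<otimes>\<^sub>m an))) \<cdot> (dl \<otimes>\<^sub>m dl) \<cdot> dl"
      unfolding conv_def Dn_1 mu2_def by (simp add: cmp_assoc)
    also have "(id1 \<otimes>\<^sub>m tau \<otimes>\<^sub>m id1) \<cdot> ((id1 \<otimes>\<^sub>m id1) \<otimes>\<^sub>m (an \<otimes>\<^sub>m an))
        = ((id1 \<otimes>\<^sub>m an) \<otimes>\<^sub>m (id1 \<otimes>\<^sub>m an)) \<cdot> (id1 \<otimes>\<^sub>m tau \<otimes>\<^sub>m id1)"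
      by (rule middle_swap_natural) simp_all
    also have "(mu \<otimes>\<^sub>m mu) \<cdot> (\<dots>) \<cdot> (dl \<otimes>\<^sub>m dl) \<cdot> dl
        = (mu \<otimes>\<^sub>m mu) \<cdot> ((id1 \<otimes>\<^sub>m an) \<otimes>\<^sub>m (id1 \<otimes>\<^sub>m an)) \<cdot> (id1 \<otimes>\<^sub>m tau \<otimes>\<^sub>m id1) \<cdot> (dl \<otimes>\<^sub>m dl) \<cdot> dl"
      by (simp add: cmp_assoc)
    \<comment> \<open>Cocommutativity enters here: in general an antipode reverses the order of the
      tensor factors, and the middle swap cannot be dropped.\<close>
    also have "(id1 \<otimes>\<^sub>m tau \<otimes>\<^sub>m id1) \<cdot> (dl \<otimes>\<^sub>m dl) \<cdot> dl = (dl \<otimes>\<^sub>m dl) \<cdot> dl"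
      using Dn_middle_swap[of "Suc 0"] unfolding Dn_1 .
    also have "(mu \<otimes>\<^sub>m mu) \<cdot> ((id1 \<otimes>\<^sub>m an) \<otimes>\<^sub>m (id1 \<otimes>\<^sub>m an)) \<cdot> (dl \<otimes>\<^sub>m dl) \<cdot> dl
        = ((mu \<cdot> (id1 \<otimes>\<^sub>m an) \<cdot> dl) \<otimes>\<^sub>m (mu \<cdot> (id1 \<otimes>\<^sub>m an) \<cdot> dl)) \<cdot> dl"
      by (simp add: tns_cmp flip: cmp_assoc)
    also have "\<dots> = ((un \<otimes>\<^sub>m un) \<cdot> (ep \<otimes>\<^sub>m ep)) \<cdot> dl"
      unfolding antipode by (simp add: tns_cmp)
    also have "\<dots> = ?e"
      by (simp add: cmp_assoc ep_ep_dl)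
    finally show ?thesis .
  qed
  have "dl \<cdot> an = ?c (dl \<cdot> an) ?e"
    by (rule conv_unitR[of _ 2, symmetric]) (simp_all add: mu2_un2)
  also have "\<dots> = ?c (?c (dl \<cdot> an) dl) ((an \<otimes>\<^sub>m an) \<cdot> dl)"
    unfolding 2[symmetric] by (rule conv_assoc[of _ 2, symmetric]) (simp_all add: mu2_assoc)
  also have "\<dots> = (an \<otimes>\<^sub>m an) \<cdot> dl"
    unfolding 1 by (rule conv_unitL[of _ 2]) (simp_all add: mu2_un2)
  finally show ?thesis .
qed

lemma coalg_mor_an:
  assumes "coalg_mor l h"
  shows "coalg_mor l (an \<cdot> h)"
proof -
  note [simp] = coalg_morD(1,2)[OF assms]
  have "ep \<cdot> an \<cdot> h = En l"
    using assms by (simp add: ep_an coalg_morD flip: cmp_assoc)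
  moreover have "dl \<cdot> an \<cdot> h = (an \<otimes>\<^sub>m an) \<cdot> dl \<cdot> h"
    by (simp add: dl_an flip: cmp_assoc)
  then have "dl \<cdot> an \<cdot> h = ((an \<cdot> h) \<otimes>\<^sub>m (an \<cdot> h)) \<cdot> Dn l"
    using assms by (simp add: coalg_morD(4) tns_cmp flip: cmp_assoc)
  ultimately show ?thesis
    by (simp add: coalg_mor_def)
qed

lemma conv_an:
  assumes "coalg_mor l h"
  shows "conv mu l (an \<cdot> h) h = un \<cdot> En l"
proof -
  note [simp] = coalg_morD(1,2)[OF assms]
  have "(an \<cdot> h) \<otimes>\<^sub>m h = (an \<otimes>\<^sub>m id1) \<cdot> (h \<otimes>\<^sub>m h)"
    by (simp add: tns_cmp)
  then have "conv mu l (an \<cdot> h) h = mu \<cdot> (an \<otimes>\<^sub>m id1) \<cdot> dl \<cdot> h"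
    using assms by (simp add: conv_def cmp_assoc coalg_morD(4))
  also have "\<dots> = (mu \<cdot> (an \<otimes>\<^sub>m id1) \<cdot> dl) \<cdot> h"
    by (simp add: cmp_assoc)
  also have "\<dots> = un \<cdot> En l"
    unfolding antipode using assms by (simp add: cmp_assoc coalg_morD)
  finally show ?thesis .
qed

text \<open>Commutativity of \<open>mu\<close> inserts a braiding after \<open>f\<close> and
  \<open>g\<close>; naturality moves it before them, where cocommutativity of \<open>Dn l\<close>
  absorbs it.\<close>

lemma conv_commute:
  assumes "coalg_mor l f" "coalg_mor l g"
  shows "conv mu l f g = conv mu l g f"
proof -
  note [simp] = coalg_morD(1,2)[OF assms(1)] coalg_morD(1,2)[OF assms(2)]
  have "conv mu l f g = mu \<cdot> (tau \<cdot> (f \<otimes>\<^sub>m g)) \<cdot> Dn l"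
    by (simp add: conv_def mu_tau flip: cmp_assoc)
  also have "tau \<cdot> (f \<otimes>\<^sub>m g) = (g \<otimes>\<^sub>m f) \<cdot> br l l"
    by (simp add: br_natural)
  also have "mu \<cdot> (\<dots>) \<cdot> Dn l = conv mu l g f"
    by (simp add: conv_def cmp_assoc br_Dn)
  finally show ?thesis .
qed

section \<open>The convolution group as a HOL-Algebra structure\<close>

definition coalg_group :: "nat \<Rightarrow> mor monoid" where
  "coalg_group l = \<lparr>carrier = {h. coalg_mor l h}, mult = conv mu l, one = un \<cdot> En l\<rparr>"

lemma coalg_group_simps [simp]:
  "carrier (coalg_group l) = {h. coalg_mor l h}"
  "mult (coalg_group l) = conv mu l"
  "one (coalg_group l) = un \<cdot> En l"
  by (simp_all add: coalg_group_def)

lemma comm_group_coalg_group: "comm_group (coalg_group l)"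
proof (rule comm_groupI)
  fix x y z
  assume *: "x \<in> carrier (coalg_group l)" "y \<in> carrier (coalg_group l)" "z \<in> carrier (coalg_group l)"
  then show "x \<otimes>\<^bsub>coalg_group l\<^esub> y \<otimes>\<^bsub>coalg_group l\<^esub> z = x \<otimes>\<^bsub>coalg_group l\<^esub> (y \<otimes>\<^bsub>coalg_group l\<^esub> z)"
    by (auto simp: coalg_morD mu_assoc intro!: conv_assoc[of _ "Suc 0"])
next
  fix x
  assume *: "x \<in> carrier (coalg_group l)"
  then show "\<one>\<^bsub>coalg_group l\<^esub> \<otimes>\<^bsub>coalg_group l\<^esub> x = x"
    by (auto simp: coalg_morD mu_un intro!: conv_unitL[of _ "Suc 0"])
  show "\<exists>y\<in>carrier (coalg_group l). y \<otimes>\<^bsub>coalg_group l\<^esub> x = \<one>\<^bsub>coalg_group l\<^esub>"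
    using * by (auto intro!: exI[of _ "an \<cdot> x"] coalg_mor_an conv_an)
qed (auto simp: coalg_mor_conv coalg_mor_unit conv_commute)

section \<open>A term is determined by its action on generic group elements\<close>

text \<open>The pairing of comonoid morphisms for which the tensor power is a product: the
  \<open>l\<close> inputs are copied once for each component. The empty tuple discards them by the
  counit.\<close>

fun tuple :: "nat \<Rightarrow> mor list \<Rightarrow> mor" where
  "tuple l [] = En l"
| "tuple l (h # hs) = (h \<otimes>\<^sub>m tuple l hs) \<cdot> Dn l"

lemma tuple_typed:
  "\<forall>h\<in>set hs. coalg_mor l h \<Longrightarrow> src_m (tuple l hs) = l \<and> tgt_m (tuple l hs) = length hs"
  by (induction hs) (auto simp: coalg_morD)

lemma src_tuple [simp]: "\<forall>h\<in>set hs. coalg_mor l h \<Longrightarrow> src_m (tuple l hs) = l"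
  and tgt_tuple [simp]: "\<forall>h\<in>set hs. coalg_mor l h \<Longrightarrow> tgt_m (tuple l hs) = length hs"
  by (auto dest: tuple_typed)

lemma tuple_single: "coalg_mor l h \<Longrightarrow> tuple l [h] = h"
proof -
  assume "coalg_mor l h"
  note [simp] = coalg_morD(1,2)[OF this]
  have "h \<otimes>\<^sub>m En l = h \<cdot> (idm l \<otimes>\<^sub>m En l)"
    using tns_cmp[of h "idm l" "idm 0" "En l"] by simp
  then show ?thesis
    by (simp add: cmp_assoc En_Dn)
qed

text \<open>Coassociativity allows the copying to be cut at any position. This is what lets a tensor
  product of terms act on each half of a tuple separately.\<close>

lemma tuple_append:
  assumes "\<forall>h\<in>set xs. coalg_mor l h" "\<forall>h\<in>set ys. coalg_mor l h"
  shows "tuple l (xs @ ys) = (tuple l xs \<otimes>\<^sub>m tuple l ys) \<cdot> Dn l"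
  using assms(1)
proof (induction xs)
  case Nil
  have "En l \<otimes>\<^sub>m tuple l ys = tuple l ys \<cdot> (En l \<otimes>\<^sub>m idm l)"
    using assms(2) tns_cmp[of "idm 0" "En l" "tuple l ys" "idm l"] by simp
  then show ?case
    using assms(2) by (simp add: cmp_assoc En_Dn)
next
  case (Cons h xs)
  then have h [simp]: "src_m h = l" and xs: "\<forall>h\<in>set xs. coalg_mor l h"
    by (auto simp: coalg_morD)
  note [simp] = xs assms(2)
  have "tuple l ((h # xs) @ ys) = (h \<otimes>\<^sub>m ((tuple l xs \<otimes>\<^sub>m tuple l ys) \<cdot> Dn l)) \<cdot> Dn l"
    using Cons by simp
  also have "h \<otimes>\<^sub>m ((tuple l xs \<otimes>\<^sub>m tuple l ys) \<cdot> Dn l)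
      = (h \<otimes>\<^sub>m (tuple l xs \<otimes>\<^sub>m tuple l ys)) \<cdot> (idm l \<otimes>\<^sub>m Dn l)"
    by (simp add: tns_cmp)
  also have "(\<dots>) \<cdot> Dn l = ((h \<otimes>\<^sub>m tuple l xs) \<otimes>\<^sub>m tuple l ys) \<cdot> (Dn l \<otimes>\<^sub>m idm l) \<cdot> Dn l"
    by (simp add: cmp_assoc Dn_coassoc tns_assoc)
  also have "\<dots> = (tuple l (h # xs) \<otimes>\<^sub>m tuple l ys) \<cdot> Dn l"
    by (simp add: tns_cmp flip: cmp_assoc)
  finally show ?case .
qed

text \<open>By naturality the braiding moves to the copies of the inputs, which are
  indistinguishable by \<open>br_Dn\<close>; hence braidings merely permute components.\<close>

lemma tuple_swap:
  assumes "\<forall>h\<in>set xs. coalg_mor l h" "\<forall>h\<in>set ys. coalg_mor l h"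
  shows "br (length xs) (length ys) \<cdot> tuple l (xs @ ys) = tuple l (ys @ xs)"
proof -
  note [simp] = assms
  have "br (length xs) (length ys) \<cdot> tuple l (xs @ ys)
      = (br (length xs) (length ys) \<cdot> (tuple l xs \<otimes>\<^sub>m tuple l ys)) \<cdot> Dn l"
    by (simp add: tuple_append cmp_assoc)
  also have "\<dots> = (tuple l ys \<otimes>\<^sub>m tuple l xs) \<cdot> br l l \<cdot> Dn l"
    by (simp add: br_natural cmp_assoc)
  finally show ?thesis
    by (simp add: br_Dn tuple_append)
qed

text \<open>The projections are \<open>prj l r\<close> for \<open>r < l\<close>; other values are junk.\<close>
fun prj :: "nat \<Rightarrow> nat \<Rightarrow> mor" where
  "prj 0 r = idm 0"
| "prj (Suc n) 0 = id1 \<otimes>\<^sub>m En n"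
| "prj (Suc n) (Suc r) = ep \<otimes>\<^sub>m prj n r"

lemma coalg_mor_ep_tns:
  assumes "coalg_mor n h"
  shows "coalg_mor (Suc n) (ep \<otimes>\<^sub>m h)"
proof -
  note [simp] = coalg_morD(1,2)[OF assms]
  have "ep \<cdot> (ep \<otimes>\<^sub>m h) = En (Suc n)"
    using tns_cmp[of "idm 0" ep ep h] assms by (simp add: coalg_morD)
  moreover have "dl \<cdot> (ep \<otimes>\<^sub>m h) = ep \<otimes>\<^sub>m ((h \<otimes>\<^sub>m h) \<cdot> Dn n)"
    using tns_cmp[of "idm 0" ep dl h] assms by (simp add: coalg_morD)
  then have "dl \<cdot> (ep \<otimes>\<^sub>m h) = ((ep \<otimes>\<^sub>m h) \<otimes>\<^sub>m (ep \<otimes>\<^sub>m h)) \<cdot> Dn (Suc n)"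
    by (subst tns_Dn_Suc) (simp_all add: ep_ep_dl tns_id)
  ultimately show ?thesis
    by (simp add: coalg_mor_def del: Dn.simps)
qed

lemma coalg_mor_tns_En: "coalg_mor (Suc n) (id1 \<otimes>\<^sub>m En n)"
proof -
  have "ep \<cdot> (id1 \<otimes>\<^sub>m En n) = En (Suc n)"
    using tns_cmp[of ep id1 "idm 0" "En n"] by simp
  moreover have "dl \<cdot> (id1 \<otimes>\<^sub>m En n) = dl \<otimes>\<^sub>m En n"
    using tns_cmp[of dl id1 "idm 0" "En n"] by simp
  then have "dl \<cdot> (id1 \<otimes>\<^sub>m En n) = ((id1 \<otimes>\<^sub>m En n) \<otimes>\<^sub>m (id1 \<otimes>\<^sub>m En n)) \<cdot> Dn (Suc n)"
    by (subst tns_Dn_Suc) (simp_all add: En_En_Dn tns_id)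
  ultimately show ?thesis
    by (simp add: coalg_mor_def del: Dn.simps)
qed

lemma coalg_mor_prj: "r < l \<Longrightarrow> coalg_mor l (prj l r)"
proof (induction l r rule: prj.induct)
  case (2 n)
  then show ?case by (simp add: coalg_mor_tns_En)
next
  case (3 n r)
  then show ?case by (simp add: coalg_mor_ep_tns)
qed simp

lemma tuple_ep_tns:
  assumes "\<forall>h\<in>set hs. coalg_mor n h"
  shows "tuple (Suc n) (map (\<lambda>h. ep \<otimes>\<^sub>m h) hs) = ep \<otimes>\<^sub>m tuple n hs"
  using assms
proof (induction hs)
  case (Cons h hs)
  then have [simp]: "src_m h = n" "tgt_m h = Suc 0" "\<forall>h\<in>set hs. coalg_mor n h"
    by (auto simp: coalg_morD)
  have "tuple (Suc n) (map (\<lambda>h. ep \<otimes>\<^sub>m h) (h # hs))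
      = ((ep \<otimes>\<^sub>m h) \<otimes>\<^sub>m (ep \<otimes>\<^sub>m tuple n hs)) \<cdot> Dn (Suc n)"
    using Cons by (simp del: Dn.simps)
  also have "\<dots> = ep \<otimes>\<^sub>m tuple n (h # hs)"
    by (subst tns_Dn_Suc) (simp_all add: ep_ep_dl tns_id)
  finally show ?case .
qed simp

lemma tuple_prj: "tuple l (map (prj l) [0..<l]) = idm l"
proof (induction l)
  case (Suc n)
  have "map (prj (Suc n)) [0..<Suc n]
      = (id1 \<otimes>\<^sub>m En n) # map (\<lambda>h. ep \<otimes>\<^sub>m h) (map (prj n) [0..<n])"
    unfolding upt_conv_Cons[OF zero_less_Suc] map_Suc_upt[symmetric] by (simp add: comp_def)
  then have "tuple (Suc n) (map (prj (Suc n)) [0..<Suc n])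
      = ((id1 \<otimes>\<^sub>m En n) \<otimes>\<^sub>m tuple (Suc n) (map (\<lambda>h. ep \<otimes>\<^sub>m h) (map (prj n) [0..<n]))) \<cdot> Dn (Suc n)"
    by (simp del: Dn.simps)
  also have "tuple (Suc n) (map (\<lambda>h. ep \<otimes>\<^sub>m h) (map (prj n) [0..<n]))
      = ep \<otimes>\<^sub>m tuple n (map (prj n) [0..<n])"
    by (rule tuple_ep_tns) (auto intro: coalg_mor_prj)
  also have "\<dots> = ep \<otimes>\<^sub>m idm n"
    by (simp add: Suc)
  also have "((id1 \<otimes>\<^sub>m En n) \<otimes>\<^sub>m (ep \<otimes>\<^sub>m idm n)) \<cdot> Dn (Suc n) = idm (Suc n)"
    by (subst tns_Dn_Suc) (simp_all add: ep_dl En_Dn tns_id)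
  finally show ?case .
qed simp

text \<open>The group homomorphism from the free abelian group to the convolution group that sends
  the generator of index \<open>r < l\<close> to the projection \<open>prj l r\<close>. Generators
  of larger index go to the unit, so one group of countable rank serves every
  \<open>l\<close>.\<close>

definition phi :: "nat \<Rightarrow> grp \<Rightarrow> mor" where
  "phi l g = finprod (coalg_group l) (\<lambda>r. prj l r [^]\<^bsub>coalg_group l\<^esub> Poly_Mapping.lookup g r) {..<l}"

lemma prj_in_carrier: "r < l \<Longrightarrow> prj l r \<in> carrier (coalg_group l)"
  by (simp add: coalg_mor_prj)

lemma coalg_mor_phi [simp]: "coalg_mor l (phi l g)"
proof -
  interpret comm_group "coalg_group l" by (rule comm_group_coalg_group)
  have "phi l g \<in> carrier (coalg_group l)"
    unfolding phi_def by (rule finprod_closed) (auto simp del: coalg_group_simps intro: int_pow_closed prj_in_carrier)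
  then show ?thesis by simp
qed

lemma phi_0: "phi l 0 = un \<cdot> En l"
proof -
  interpret comm_group "coalg_group l" by (rule comm_group_coalg_group)
  have "phi l 0 = \<one>\<^bsub>coalg_group l\<^esub>"
    unfolding phi_def by (rule finprod_one_eqI) (simp add: int_pow_0 del: coalg_group_simps)
  then show ?thesis by simp
qed

lemma phi_add: "phi l (g + h) = conv mu l (phi l g) (phi l h)"
proof -
  interpret comm_group "coalg_group l" by (rule comm_group_coalg_group)
  have "phi l (g + h) = finprod (coalg_group l) (\<lambda>r. prj l r [^]\<^bsub>coalg_group l\<^esub> Poly_Mapping.lookup g r
      \<otimes>\<^bsub>coalg_group l\<^esub> prj l r [^]\<^bsub>coalg_group l\<^esub> Poly_Mapping.lookup h r) {..<l}"
    unfolding phi_def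
    by (rule finprod_cong')
      (auto simp: lookup_add int_pow_mult prj_in_carrier simp del: coalg_group_simps
         intro!: m_closed int_pow_closed prj_in_carrier)
  also have "\<dots> = phi l g \<otimes>\<^bsub>coalg_group l\<^esub> phi l h"
    unfolding phi_def
    by (rule finprod_multf) (auto simp del: coalg_group_simps intro!: int_pow_closed prj_in_carrier)
  finally show ?thesis by simp
qed

text \<open>Both sides invert \<open>phi l g\<close>: the left one because \<open>phi l\<close> is
  additive, the right one by the antipode relation. Inverses in a group are unique.\<close>

lemma phi_uminus: "phi l (- g) = an \<cdot> phi l g"
proof -
  interpret comm_group "coalg_group l" by (rule comm_group_coalg_group)
  have "inv\<^bsub>coalg_group l\<^esub> phi l g = phi l (- g)"
    by (rule inv_equality) (simp_all flip: phi_add phi_0)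
  moreover have "inv\<^bsub>coalg_group l\<^esub> phi l g = an \<cdot> phi l g"
    by (rule inv_equality) (simp_all add: conv_an coalg_mor_an)
  ultimately show ?thesis by simp
qed

lemma phi_single: "r < l \<Longrightarrow> phi l (Poly_Mapping.single r 1) = prj l r"
proof -
  assume r: "r < l"
  interpret comm_group "coalg_group l" by (rule comm_group_coalg_group)
  have "phi l (Poly_Mapping.single r 1)
      = finprod (coalg_group l) (\<lambda>i. if r = i then prj l i else \<one>\<^bsub>coalg_group l\<^esub>) {..<l}"
    unfolding phi_def
    by (rule finprod_cong')
      (auto simp: lookup_single when_def int_pow_1 int_pow_0 prj_in_carrier simp del: coalg_group_simps
         intro: prj_in_carrier)
  also have "\<dots> = prj l r"
    using r by (intro finprod_singleton) (auto simp del: coalg_group_simps intro: prj_in_carrier)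
  finally show ?thesis .
qed

section \<open>Evaluation of terms on tuples of group elements\<close>

fun ev :: "tm \<Rightarrow> grp list \<Rightarrow> grp list" where
  "ev (Id n) xs = xs"
| "ev (Br a b) xs = drop a xs @ take a xs"
| "ev (BrI a b) xs = drop b xs @ take b xs"
| "ev (Gen w) xs = the (gen_ev w xs)"
| "ev (Comp f g) xs = ev f (ev g xs)"
| "ev (Tens f g) xs = ev f (take (src f) xs) @ ev g (drop (src f) xs)"

lemma gen_ev_cases:
  assumes "length xs = gsrc w"
  obtains g h where "w = Mu" "xs = [g, h]"
  | "w = Unit" "xs = []"
  | g where "w = Delta" "xs = [g]"
  | g where "w = Eps" "xs = [g]"
  | g where "w = Ant" "xs = [g]"
  using assms by (cases w) (auto simp: numeral_2_eq_2 length_Suc_conv)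

lemma length_ev [simp]: "wf t \<Longrightarrow> length xs = src t \<Longrightarrow> length (ev t xs) = tgt t"
proof (induction t arbitrary: xs)
  case (Gen w)
  then have "length xs = gsrc w" by simp
  then show ?case by (cases rule: gen_ev_cases) auto
qed auto

lemma abs_simps:
  "abs_mor (Id n) = idm n" "abs_mor (Br a b) = br a b" "abs_mor (BrI a b) = bri a b"
  "abs_mor (Gen w) = gn w"
  by (simp_all add: idm.abs_eq br.abs_eq bri.abs_eq gn.abs_eq)

lemma src_abs [simp]: "wf t \<Longrightarrow> src_m (abs_mor t) = src t"
  and tgt_abs [simp]: "wf t \<Longrightarrow> tgt_m (abs_mor t) = tgt t"
  by (simp_all add: src_m.abs_eq tgt_m.abs_eq eqv_self_iff)

lemma abs_Comp: "wf (Comp f g) \<Longrightarrow> abs_mor (Comp f g) = abs_mor f \<cdot> abs_mor g"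
  by (simp add: cmp.abs_eq eqv_self_iff)
lemma abs_Tens: "wf (Tens f g) \<Longrightarrow> abs_mor (Tens f g) = abs_mor f \<otimes>\<^sub>m abs_mor g"
  by (simp add: tns.abs_eq eqv_self_iff)

text \<open>On comonoid morphisms the generators act as convolution product, unit, duplication,
  deletion and inverse, the braidings as block swaps. Since \<open>phi l\<close> is a homomorphism,
  applying a term to images under \<open>phi l\<close> is the same as evaluating it on group
  elements first, and this passes through compositions and tensors.\<close>

lemma abs_tuple:
  "wf t \<Longrightarrow> length xs = src t \<Longrightarrow>
    abs_mor t \<cdot> tuple l (map (phi l) xs) = tuple l (map (phi l) (ev t xs))"
proof (induction t arbitrary: xs)
  case (Id n)
  then show ?case by (simp add: abs_simps)
next
  case (Br a b)
  then show ?case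
    using tuple_swap[of "map (phi l) (take a xs)" l "map (phi l) (drop a xs)"]
    by (simp add: abs_simps min_absorb2 flip: map_append)
next
  case (BrI a b)
  let ?y = "map (phi l) (drop b xs @ take b xs)"
  have y: "src_m (tuple l ?y) = l" "tgt_m (tuple l ?y) = a + b"
  proof -
    have *: "\<forall>h\<in>set ?y. coalg_mor l h"
      by auto
    show "src_m (tuple l ?y) = l" "tgt_m (tuple l ?y) = a + b"
      using src_tuple[OF *] tgt_tuple[OF *] BrI by (simp_all only: length_map length_append length_drop length_take) simp
  qed
  \<comment> \<open>Writing the input as a braiding applied to the swapped tuple lets the inverse
    braiding cancel, so that only \<open>bri_br\<close> is used.\<close>
  have "tuple l (map (phi l) (take b xs @ drop b xs)) = br a b \<cdot> tuple l ?y"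
    using BrI tuple_swap[of "map (phi l) (drop b xs)" l "map (phi l) (take b xs)"]
    by (simp add: min_absorb2 del: append_take_drop_id)
  then have "bri a b \<cdot> tuple l (map (phi l) xs) = (bri a b \<cdot> br a b) \<cdot> tuple l ?y"
    using y by (subst cmp_assoc) simp_all
  then show ?case
    using BrI y by (simp add: bri_br abs_simps)
next
  case (Gen w)
  have ph: "src_m (phi l g) = l" "tgt_m (phi l g) = Suc 0" for g
    by (rule coalg_morD[OF coalg_mor_phi])+
  from Gen have "length xs = gsrc w" by simp
  then show ?case
  proof (cases rule: gen_ev_cases)
    case (1 g h)
    have "mu \<cdot> tuple l [phi l g, phi l h] = conv mu l (phi l g) (phi l h)"
      using tuple_single[of l "phi l h"] by (simp add: conv_def)
    then show ?thesis
      using 1 tuple_single[of l "phi l (g + h)"] by (simp add: abs_simps phi_add[symmetric])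
  next
    case 2
    then show ?thesis
      using tuple_single[of l "phi l 0"] by (simp add: abs_simps phi_0 coalg_mor_unit)
  next
    case (3 g)
    then show ?thesis
      using tuple_single[of l "phi l g"] by (simp add: abs_simps coalg_morD(4))
  next
    case (4 g)
    then show ?thesis
      using tuple_single[of l "phi l g"] by (simp add: abs_simps coalg_morD(3))
  next
    case (5 g)
    then show ?thesis
      using tuple_single[of l "phi l g"] tuple_single[of l "phi l (- g)"]
      by (simp add: abs_simps phi_uminus coalg_mor_an)
  qed
next
  case (Comp f g)
  have "abs_mor (Comp f g) \<cdot> tuple l (map (phi l) xs)
      = abs_mor f \<cdot> abs_mor g \<cdot> tuple l (map (phi l) xs)"
    using Comp.prems by (subst abs_Comp) (simp_all add: cmp_assoc)
  then show ?case
    using Comp by simp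
next
  case (Tens f g)
  let ?x = "map (phi l) (take (src f) xs)" and ?y = "map (phi l) (drop (src f) xs)"
  have "abs_mor (Tens f g) \<cdot> tuple l (map (phi l) xs)
      = (abs_mor f \<otimes>\<^sub>m abs_mor g) \<cdot> tuple l (?x @ ?y)"
    using Tens.prems by (simp add: abs_Tens flip: map_append)
  also have "\<dots> = ((abs_mor f \<otimes>\<^sub>m abs_mor g) \<cdot> (tuple l ?x \<otimes>\<^sub>m tuple l ?y)) \<cdot> Dn l"
    using Tens.prems by (subst tuple_append) (auto simp: cmp_assoc min_absorb2)
  also have "(abs_mor f \<otimes>\<^sub>m abs_mor g) \<cdot> (tuple l ?x \<otimes>\<^sub>m tuple l ?y)
      = (abs_mor f \<cdot> tuple l ?x) \<otimes>\<^sub>m (abs_mor g \<cdot> tuple l ?y)"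
    using Tens.prems by (intro tns_cmp) (auto simp: min_absorb2)
  also have "(\<dots>) \<cdot> Dn l = tuple l (map (phi l) (ev (Tens f g) xs))"
    using Tens.prems by (simp add: Tens.IH tuple_append)
  finally show ?case .
qed

definition basis :: "nat \<Rightarrow> grp list" where
  "basis m = map (\<lambda>r. Poly_Mapping.single r 1) [0..<m]"

lemma length_basis [simp]: "length (basis m) = m"
  by (simp add: basis_def)

lemma eqv_if_ev_basis_eq:
  assumes "wf t" "wf t'" "src t = src t'" "ev t (basis (src t)) = ev t' (basis (src t))"
  shows "eqv t t'"
proof -
  have b: "map (phi l) (basis l) = map (prj l) [0..<l]" for l
    by (simp add: basis_def phi_single)
  have "abs_mor s = tuple (src s) (map (phi (src s)) (ev s (basis (src s))))" if "wf s" for s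
    using abs_tuple[of s "basis (src s)" "src s"] that by (simp add: b tuple_prj)
  then have "abs_mor t = abs_mor t'"
    using assms by metis
  then show ?thesis
    using assms(1,2) Quotient3_rel[OF Quotient3_mor, of t t'] by (simp add: eqv_self_iff)
qed

section \<open>The action of the normal forms\<close>

lemma wf_tens_list: "wf (tens_list ts) \<longleftrightarrow> (\<forall>t\<in>set ts. wf t)"
  by (induction ts) auto
lemma src_tens_list: "src (tens_list ts) = sum_list (map src ts)"
  by (induction ts) auto
lemma tgt_tens_list: "tgt (tens_list ts) = sum_list (map tgt ts)"
  by (induction ts) auto

lemma ev_tens_list_append:
  "length xs = sum_list (map src as) \<Longrightarrow>
    ev (tens_list (as @ bs)) (xs @ ys) = ev (tens_list as) xs @ ev (tens_list bs) ys"
  by (induction as arbitrary: xs) auto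

lemma ev_tens_list_concat:
  "\<forall>i\<in>set is. length (X i) = sum_list (map src (T i)) \<Longrightarrow>
    ev (tens_list (concat (map T is))) (concat (map X is)) = concat (map (\<lambda>i. ev (tens_list (T i)) (X i)) is)"
  by (induction "is") (auto simp: ev_tens_list_append)

lemma ev_tens_list_map:
  "\<forall>i\<in>set is. length (X i) = src (T i) \<Longrightarrow>
    ev (tens_list (map T is)) (concat (map X is)) = concat (map (\<lambda>i. ev (T i) (X i)) is)"
  by (induction "is") auto

lemma delta_iter_typed: "wf (delta_iter p) \<and> src (delta_iter p) = 1 \<and> tgt (delta_iter p) = p"
  by (induction p rule: delta_iter.induct) auto

lemma ev_delta_iter: "ev (delta_iter p) [g] = replicate p g"
  by (induction p rule: delta_iter.induct) auto

lemma mult_iter_typed: "wf (mult_iter p) \<and> src (mult_iter p) = p \<and> tgt (mult_iter p) = 1"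
  by (induction p rule: mult_iter.induct) auto

lemma ev_mult_iter: "length xs = p \<Longrightarrow> ev (mult_iter p) xs = [sum_list xs]"
proof (induction p arbitrary: xs rule: mult_iter.induct)
  case (3 p)
  then obtain x ys where xs: "xs = x # ys" "length ys = Suc p"
    by (cases xs) auto
  then show ?case
    using "3.IH"[of ys] by simp
qed (auto simp: length_Suc_conv)

section \<open>Permutations of strands\<close>

lemma swap_at_typed:
  "Suc j < N \<Longrightarrow> wf (swap_at j N) \<and> src (swap_at j N) = N \<and> tgt (swap_at j N) = N"
  by (simp add: swap_at_def)

lemma move_front_typed:
  "j < N \<Longrightarrow> wf (move_front j N) \<and> src (move_front j N) = N \<and> tgt (move_front j N) = N"
  by (induction j) (simp_all add: swap_at_typed)

lemma ev_swap_at: "ev (swap_at (length as) (length (as @ a # b # bs))) (as @ a # b # bs) = as @ b # a # bs"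
  by (simp add: swap_at_def)

lemma ev_move_front: "ev (move_front (length as) (length (as @ a # bs))) (as @ a # bs) = a # as @ bs"
proof (induction as arbitrary: a bs rule: rev_induct)
  case (snoc c as)
  show ?case
    using ev_swap_at[of as c a bs] snoc[of a "c # bs"] by simp
qed simp

text \<open>Once strand \<open>j\<close> stands in front, the strands to its right lose one from
  their index. The shift could only identify \<open>j\<close> with \<open>j + 1\<close>, and
  \<open>j\<close> does not recur in the tail, so it is injective; counting then shows that all
  indices are hit.\<close>

lemma perm_list_tl:
  assumes "distinct (j # rest)" "set (j # rest) = {..<Suc (length rest)}"
  defines "rest' \<equiv> map (\<lambda>x. if j < x then x - 1 else x) rest"
  shows "distinct rest'" "set rest' = {..<length rest'}"
proof -
  have inj: "inj_on (\<lambda>x. if j < x then x - 1 else x) (set rest)"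
    using assms(1) by (auto simp: inj_on_def split: if_splits) (metis Suc_pred less_SucE less_imp_Suc_add zero_less_Suc)+
  then show d: "distinct rest'"
    using assms(1) by (simp add: rest'_def distinct_map)
  have "set rest' \<subseteq> {..<length rest'}"
  proof
    fix y assume "y \<in> set rest'"
    then obtain x where x: "x \<in> set rest" "y = (if j < x then x - 1 else x)"
      by (auto simp: rest'_def)
    moreover have "x < Suc (length rest)" "j < Suc (length rest)" "x \<noteq> j"
      using assms(1,2) x(1) by auto
    ultimately show "y \<in> {..<length rest'}"
      by (auto simp: rest'_def split: if_splits)
  qed
  then show "set rest' = {..<length rest'}"
    using distinct_card[OF d] by (intro card_subset_eq) auto
qed

lemma perm_term_typed:
  "distinct \<sigma> \<Longrightarrow> set \<sigma> = {..<length \<sigma>} \<Longrightarrow>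
    wf (perm_term \<sigma>) \<and> src (perm_term \<sigma>) = length \<sigma> \<and> tgt (perm_term \<sigma>) = length \<sigma>"
proof (induction \<sigma> rule: perm_term.induct)
  case (2 j rest)
  then have "j < Suc (length rest)" by auto
  then show ?case
    using "2.IH" perm_list_tl[of j rest] "2.prems" move_front_typed[of j "Suc (length rest)"] by simp
qed simp

lemma ev_perm_term:
  "distinct \<sigma> \<Longrightarrow> set \<sigma> = {..<length \<sigma>} \<Longrightarrow> length xs = length \<sigma> \<Longrightarrow>
    ev (perm_term \<sigma>) xs = map ((!) xs) \<sigma>"
proof (induction \<sigma> arbitrary: xs rule: perm_term.induct)
  case (2 j rest)
  let ?rest = "map (\<lambda>x. if j < x then x - 1 else x) rest"
  let ?ys = "take j xs @ drop (Suc j) xs"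
  have j: "j < length xs"
    using "2.prems" by auto
  have "ev (perm_term ?rest) ?ys = map ((!) ?ys) ?rest"
    using "2.prems" j perm_list_tl[of j rest] by (intro "2.IH") auto
  also have "\<dots> = map ((!) xs) rest"
  proof -
    have "?ys ! (if j < x then x - 1 else x) = xs ! x" if "x \<in> set rest" for x
    proof -
      have "x \<noteq> j"
        using that "2.prems"(1) by auto
      moreover have "x < length xs"
        using that "2.prems"(2,3) by auto
      ultimately show ?thesis
        by (cases "j < x") (auto simp: nth_append)
    qed
    then show ?thesis by simp
  qed
  finally have *: "ev (perm_term ?rest) ?ys = map ((!) xs) rest" .
  show ?case
  proof -
    have "xs = take j xs @ xs ! j # drop (Suc j) xs"
      using j by (rule id_take_nth_drop)
    moreover have "length (take j xs) = j"
      using j by simp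
    ultimately have "ev (move_front j (length xs)) xs = xs ! j # ?ys"
      using ev_move_front[of "take j xs" "xs ! j" "drop (Suc j) xs"] by metis
    with * show ?thesis
      using "2.prems"(3) by simp
  qed
qed simp

section \<open>Positions in concatenated blocks\<close>

lemma sum_list_upt: "sum_list (map f [0..<m]) = (\<Sum>r<m. f r)" for f :: "nat \<Rightarrow> 'a::comm_monoid_add"
  by (induction m) (simp_all add: add.commute)

lemma length_concat_upt: "length (concat (map F [0..<m])) = (\<Sum>r<m. length (F r))"
  by (induction m) simp_all

text \<open>A position below the total length is an offset of a block plus a place in that block. It
  is used on two levels: for the copies of all inputs, and for the copies of one input distributed
  over the tensor factors.\<close>

lemma sum_lessThan_block:
  fixes N :: "nat \<Rightarrow> nat"
  shows "i < (\<Sum>r<m. N r) \<longleftrightarrow> (\<exists>r<m. \<exists>c<N r. i = (\<Sum>r'<r. N r') + c)"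
proof (induction m)
  case (Suc m)
  have "i < (\<Sum>r<Suc m. N r) \<longleftrightarrow> i < (\<Sum>r<m. N r) \<or> (\<exists>c<N m. i = (\<Sum>r'<m. N r') + c)"
  proof -
    have "i < a + b \<longleftrightarrow> i < a \<or> (\<exists>c<b. i = a + c)" for a b :: nat
      by (cases "i < a") (auto intro!: exI[of _ "i - a"])
    then show ?thesis
      unfolding sum.lessThan_Suc .
  qed
  then show ?case
    unfolding Suc by (auto simp: less_Suc_eq)
qed simp

lemma nth_concat_block:
  "r < m \<Longrightarrow> c < length (F r) \<Longrightarrow>
    concat (map F [0..<m]) ! ((\<Sum>r'<r. length (F r')) + c) = F r ! c"
proof (induction m)
  case (Suc m)
  have len: "length (concat (map F [0..<m])) = (\<Sum>r'<m. length (F r'))"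
    by (rule length_concat_upt)
  show ?case
  proof (cases "r = m")
    case True
    then show ?thesis
      using len by (simp add: nth_append)
  next
    case False
    then have "r < m"
      using Suc.prems by simp
    then have "(\<Sum>r'<r. length (F r')) + c < (\<Sum>r'<m. length (F r'))"
      unfolding sum_lessThan_block using Suc.prems by blast
    then show ?thesis
      using False Suc len by (simp add: nth_append)
  qed
qed simp

lemma sum_list_concat: "sum_list (concat xss) = sum_list (map sum_list xss)"
  by (induction xss) auto

text \<open>The list runs through the factors \<open>k\<close> first, the positions are numbered by
  inputs \<open>r\<close> first; exchanging the two sums shows that the lengths agree. Every
  position occurs by decomposing it twice into blocks, and a list with as many entries as values has
  no repetition.\<close>

lemma block_perm:
  fixes p :: "nat \<Rightarrow> nat \<Rightarrow> nat" and m n :: nat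
  defines "N \<equiv> \<lambda>r. \<Sum>k<n. p k r"
  defines "\<sigma> \<equiv> concat (map (\<lambda>k. concat (map (\<lambda>r. map (\<lambda>j. (\<Sum>r'<r. N r') + ((\<Sum>k'<k. p k' r) + j))
    [0..<p k r]) [0..<m])) [0..<n])"
  shows "length \<sigma> = (\<Sum>r<m. N r)" "distinct \<sigma>" "set \<sigma> = {..<length \<sigma>}"
proof -
  have "length \<sigma> = (\<Sum>k<n. \<Sum>r<m. p k r)"
    by (simp add: \<sigma>_def length_concat_upt)
  also have "\<dots> = (\<Sum>r<m. N r)"
    unfolding N_def by (rule sum.swap)
  finally show len: "length \<sigma> = (\<Sum>r<m. N r)" .
  have "set \<sigma> = {i. \<exists>r<m. \<exists>k<n. \<exists>j<p k r. i = (\<Sum>r'<r. N r') + ((\<Sum>k'<k. p k' r) + j)}"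
  proof -
    have "set \<sigma> = (\<Union>k<n. \<Union>r<m. (\<lambda>j. (\<Sum>r'<r. N r') + ((\<Sum>k'<k. p k' r) + j)) ` {..<p k r})"
      by (simp add: \<sigma>_def atLeast0LessThan)
    then show ?thesis by blast
  qed
  also have "\<dots> = {i. \<exists>r<m. \<exists>c<N r. i = (\<Sum>r'<r. N r') + c}"
  proof -
    have "(\<exists>k<n. \<exists>j<p k r. i = a + ((\<Sum>k'<k. p k' r) + j)) \<longleftrightarrow> (\<exists>c<N r. i = a + c)" for i a r
      unfolding N_def sum_lessThan_block by blast
    then show ?thesis by simp
  qed
  also have "\<dots> = {..<length \<sigma>}"
    unfolding len using sum_lessThan_block[of _ N m] by blast
  finally show set: "set \<sigma> = {..<length \<sigma>}" .
  show "distinct \<sigma>"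
    by (rule card_distinct) (simp add: set)
qed

section \<open>The layers of a normal form: copy, permute, invert, multiply\<close>

context
  fixes m n :: nat and s :: "nat \<Rightarrow> nat \<Rightarrow> int"
begin

abbreviation (input) "expo k r \<equiv> nat \<bar>s k r\<bar>"
abbreviation (input) "total_expo r \<equiv> \<Sum>k<n. expo k r"
abbreviation (input) "sign_gen k r \<equiv> if s k r < 0 then Gen Ant else Id 1"

definition "layer1 = tens_list (map (\<lambda>r. delta_iter (total_expo r)) [0..<m])"
definition "strands = concat (map (\<lambda>k. concat (map (\<lambda>r. map (\<lambda>j. (\<Sum>r'<r. total_expo r') + ((\<Sum>k'<k. expo k' r) + j))
    [0..<expo k r]) [0..<m])) [0..<n])"
definition "layer3 = tens_list (concat (map (\<lambda>k. concat (map (\<lambda>r. replicate (expo k r) (sign_gen k r)) [0..<m])) [0..<n]))"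
definition "layer4 = tens_list (map (\<lambda>k. mult_iter (\<Sum>r<m. expo k r)) [0..<n])"

lemma psi_tm_layers: "psi_tm m n s = Comp layer4 (Comp layer3 (Comp (perm_term strands) layer1))"
  by (simp add: psi_tm_def Let_def layer1_def strands_def layer3_def layer4_def)

lemma layers_typed:
  "wf layer1" "src layer1 = m" "tgt layer1 = (\<Sum>r<m. total_expo r)"
  "wf layer3" "src layer3 = (\<Sum>r<m. total_expo r)" "tgt layer3 = (\<Sum>r<m. total_expo r)"
  "wf layer4" "src layer4 = (\<Sum>r<m. total_expo r)" "tgt layer4 = n"
proof -
  have swap: "(\<Sum>k<n. \<Sum>r<m. expo k r) = (\<Sum>r<m. total_expo r)"
    by (rule sum.swap)
  show "wf layer1" "src layer1 = m" "tgt layer1 = (\<Sum>r<m. total_expo r)"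
    by (auto simp: layer1_def wf_tens_list src_tens_list tgt_tens_list delta_iter_typed comp_def sum_list_upt)
  have sign [simp]: "src (if b then Gen Ant else Id 1) = 1" "tgt (if b then Gen Ant else Id 1) = 1" for b
    by simp_all
  show "wf layer3"
    by (auto simp: layer3_def wf_tens_list)
  show "src layer3 = (\<Sum>r<m. total_expo r)" "tgt layer3 = (\<Sum>r<m. total_expo r)"
    unfolding swap[symmetric]
    by (simp_all add: layer3_def src_tens_list tgt_tens_list map_concat comp_def sum_list_concat
        sum_list_upt sum_list_replicate del: One_nat_def)
  show "wf layer4" "tgt layer4 = n"
    by (auto simp: layer4_def wf_tens_list tgt_tens_list mult_iter_typed comp_def sum_list_upt)
  show "src layer4 = (\<Sum>r<m. total_expo r)"
    unfolding swap[symmetric]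
    by (simp add: layer4_def src_tens_list mult_iter_typed comp_def sum_list_upt)
qed

lemma strands_perm: "length strands = (\<Sum>r<m. total_expo r)" "distinct strands" "set strands = {..<length strands}"
  unfolding strands_def by (rule block_perm)+

lemma psi_tm_typed: "wf (psi_tm m n s)" "src (psi_tm m n s) = m" "tgt (psi_tm m n s) = n"
  using perm_term_typed[OF strands_perm(2,3)]
  by (simp_all add: psi_tm_layers layers_typed strands_perm(1))

lemma ev_psi_tm:
  assumes "length xs = m"
  shows "ev (psi_tm m n s) xs = map (\<lambda>k. \<Sum>r<m. sum_list (replicate (expo k r)
    (if s k r < 0 then - xs ! r else xs ! r))) [0..<n]"
proof -
  let ?x1 = "concat (map (\<lambda>r. replicate (total_expo r) (xs ! r)) [0..<m])"
  let ?x2 = "concat (map (\<lambda>k. concat (map (\<lambda>r. replicate (expo k r) (xs ! r)) [0..<m])) [0..<n])"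
  let ?y = "\<lambda>k r. if s k r < 0 then - xs ! r else xs ! r"
  let ?x3 = "concat (map (\<lambda>k. concat (map (\<lambda>r. replicate (expo k r) (?y k r)) [0..<m])) [0..<n])"
  have "xs = concat (map (\<lambda>r. [xs ! r]) [0..<m])"
    using assms map_nth[of xs] by simp
  then have "ev layer1 xs = ev layer1 (concat (map (\<lambda>r. [xs ! r]) [0..<m]))"
    by simp
  also have "\<dots> = ?x1"
    unfolding layer1_def by (subst ev_tens_list_map) (simp_all add: delta_iter_typed ev_delta_iter)
  finally have 1: "ev layer1 xs = ?x1" .
  have "ev (perm_term strands) ?x1 = map ((!) ?x1) strands"
    by (rule ev_perm_term) (simp_all add: strands_perm length_concat_upt)
  also have "\<dots> = ?x2"
  proof -
    \<comment> \<open>Each strand of block \<open>(k, r)\<close> starts in the segment of copies of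
      input \<open>r\<close>, and these copies are all equal, so only the segment matters.\<close>
    have "map (\<lambda>j. ?x1 ! ((\<Sum>r'<r. total_expo r') + ((\<Sum>k'<k. expo k' r) + j))) [0..<expo k r] = replicate (expo k r) (xs ! r)"
      if "k < n" "r < m" for k r
    proof (rule nth_equalityI)
      fix j assume "j < length (map (\<lambda>j. ?x1 ! ((\<Sum>r'<r. total_expo r') + ((\<Sum>k'<k. expo k' r) + j))) [0..<expo k r])"
      then have j: "j < expo k r" by simp
      with that have "(\<Sum>k'<k. expo k' r) + j < total_expo r"
        by (subst sum_lessThan_block) auto
      then have "?x1 ! ((\<Sum>r'<r. total_expo r') + ((\<Sum>k'<k. expo k' r) + j)) = xs ! r"
        using nth_concat_block[of r m "(\<Sum>k'<k. expo k' r) + j" "\<lambda>r. replicate (total_expo r) (xs ! r)"] that by simp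
      then show "map (\<lambda>j. ?x1 ! ((\<Sum>r'<r. total_expo r') + ((\<Sum>k'<k. expo k' r) + j))) [0..<expo k r] ! j
          = replicate (expo k r) (xs ! r) ! j"
        using j by simp
    qed simp
    then show ?thesis
      by (auto simp: strands_def map_concat comp_def intro!: arg_cong[where f = concat] map_cong)
  qed
  finally have 2: "ev (perm_term strands) ?x1 = ?x2" .
  have rep: "ev (tens_list (replicate q (sign_gen k r))) (replicate q x) = replicate q (if s k r < 0 then - x else x)"
    for q k r x
    by (induction q) auto
  have inner: "ev (tens_list (concat (map (\<lambda>r. replicate (expo k r) (sign_gen k r)) [0..<m])))
      (concat (map (\<lambda>r. replicate (expo k r) (xs ! r)) [0..<m]))
    = concat (map (\<lambda>r. replicate (expo k r) (?y k r)) [0..<m])" for k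
    by (subst ev_tens_list_concat) (auto simp: rep sum_list_replicate)
  have len: "src (sign_gen k r) = 1" for k r
    by simp
  have 3: "ev layer3 ?x2 = ?x3"
    unfolding layer3_def
    by (subst ev_tens_list_concat)
      (simp_all only: inner, simp add: len length_concat_upt map_concat comp_def sum_list_concat
        sum_list_upt sum_list_replicate del: One_nat_def)
  have "ev layer4 ?x3 = map (\<lambda>k. sum_list (concat (map (\<lambda>r. replicate (expo k r) (?y k r)) [0..<m]))) [0..<n]"
    unfolding layer4_def
    by (subst ev_tens_list_map) (simp_all add: mult_iter_typed ev_mult_iter length_concat_upt)
  also have "\<dots> = map (\<lambda>k. \<Sum>r<m. sum_list (replicate (expo k r) (?y k r))) [0..<n]"
    by (simp add: sum_list_concat comp_def sum_list_upt)
  finally show ?thesis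
    by (simp add: psi_tm_layers 1 2 3)
qed

end

section \<open>The integer matrix of a term\<close>

lemma lookup_sum_list_replicate:
  "Poly_Mapping.lookup (sum_list (replicate q (g :: grp))) i = int q * Poly_Mapping.lookup g i"
  by (induction q) (auto simp: lookup_add algebra_simps)

text \<open>The absolute value of an entry counts the copies and its sign decides on the antipode,
  so adding the copies up restores the entry itself. Thus the matrix is recovered from the value on
  the free generators.\<close>

lemma lookup_ev_psi_tm:
  assumes "k < n"
  shows "Poly_Mapping.lookup (ev (psi_tm m n s) (basis m) ! k) i = (if i < m then s k i else 0)"
proof -
  have "Poly_Mapping.lookup (ev (psi_tm m n s) (basis m) ! k) i
      = (\<Sum>r<m. if r = i then s k r else 0)"
  proof -
    have "int (nat \<bar>s k r\<bar>) * Poly_Mapping.lookup (if s k r < 0 then - basis m ! r else basis m ! r) i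
        = (if r = i then s k r else 0)" if "r < m" for r
      using that by (auto simp: basis_def lookup_single when_def)
    then show ?thesis
      using assms by (simp add: ev_psi_tm Poly_Mapping.lookup_sum lookup_sum_list_replicate)
  qed
  then show ?thesis by simp
qed

text \<open>No term introduces a generator absent from its inputs. Hence the value on
  \<open>basis m\<close> involves generators of index below \<open>m\<close> only, and a matrix with
  \<open>m\<close> columns captures it completely.\<close>

lemma ev_support:
  assumes "wf t" "length xs = src t" "\<forall>x\<in>set xs. Poly_Mapping.lookup x i = 0"
  shows "\<forall>y\<in>set (ev t xs). Poly_Mapping.lookup y i = 0"
  using assms
proof (induction t arbitrary: xs)
  case (Gen w)
  then have "length xs = gsrc w" by simp
  then show ?case
    using Gen by (cases rule: gen_ev_cases) (auto simp: lookup_add)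
next
  case (Tens f g)
  have "\<forall>y\<in>set (ev f (take (src f) xs)). Poly_Mapping.lookup y i = 0"
    "\<forall>y\<in>set (ev g (drop (src f) xs)). Poly_Mapping.lookup y i = 0"
    using Tens.prems by (intro Tens.IH; auto dest: in_set_takeD in_set_dropD)+
  then show ?case by auto
next
  case (Comp f g)
  have "\<forall>y\<in>set (ev g xs). Poly_Mapping.lookup y i = 0"
    using Comp.prems by (intro Comp.IH(2)) simp_all
  then have "\<forall>y\<in>set (ev f (ev g xs)). Poly_Mapping.lookup y i = 0"
    using Comp.prems(1,2) by (intro Comp.IH(1)) simp_all
  then show ?case by simp
next
  case (Br a b)
  have "set (ev (Br a b) xs) \<subseteq> set xs"
    by (simp add: set_take_subset set_drop_subset)
  then show ?case
    using Br.prems(3) by blast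
next
  case (BrI a b)
  have "set (ev (BrI a b) xs) \<subseteq> set xs"
    by (simp add: set_take_subset set_drop_subset)
  then show ?case
    using BrI.prems(3) by blast
qed simp

text \<open>The value 0 outside the rectangle follows the convention of \<open>Mat\<close>, under
  which a matrix is determined by its entries with \<open>k < n\<close> and
  \<open>r < m\<close>.\<close>

definition mat_of :: "tm \<Rightarrow> nat \<Rightarrow> nat \<Rightarrow> int" where
  "mat_of t k r = (if k < tgt t \<and> r < src t then Poly_Mapping.lookup (ev t (basis (src t)) ! k) r else 0)"

lemma mat_of_Mat: "mat_of t \<in> Mat (src t) (tgt t)"
  by (simp add: Mat_def mat_of_def)

lemma ev_basis_psi_tm:
  assumes "wf t"
  shows "ev (psi_tm (src t) (tgt t) (mat_of t)) (basis (src t)) = ev t (basis (src t))"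
proof (rule nth_equalityI)
  let ?m = "src t" and ?n = "tgt t"
  show "length (ev (psi_tm ?m ?n (mat_of t)) (basis ?m)) = length (ev t (basis ?m))"
    by (simp add: assms psi_tm_typed)
  fix k assume "k < length (ev (psi_tm ?m ?n (mat_of t)) (basis ?m))"
  then have k: "k < ?n" by (simp add: psi_tm_typed)
  have "Poly_Mapping.lookup (ev t (basis ?m) ! k) i = 0" if "\<not> i < ?m" for i
    using ev_support[of t "basis ?m" i] assms k that
    by (auto simp: basis_def lookup_single when_def)
  then have "Poly_Mapping.lookup (ev (psi_tm ?m ?n (mat_of t)) (basis ?m) ! k) i
      = Poly_Mapping.lookup (ev t (basis ?m) ! k) i" for i
    using k by (simp add: lookup_ev_psi_tm mat_of_def)
  then show "ev (psi_tm ?m ?n (mat_of t)) (basis ?m) ! k = ev t (basis ?m) ! k"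
    by (rule poly_mapping_eqI)
qed

lemma eqv_psi_tm: "wf t \<Longrightarrow> eqv t (psi_tm (src t) (tgt t) (mat_of t))"
  by (rule eqv_if_ev_basis_eq) (simp_all add: psi_tm_typed ev_basis_psi_tm)

lemma psi_tm_eq_imp_mat_eq:
  assumes "s \<in> Mat m n" "s' \<in> Mat m n" "ev (psi_tm m n s) (basis m) = ev (psi_tm m n s') (basis m)"
  shows "s = s'"
proof (intro ext)
  fix k r
  show "s k r = s' k r"
  proof (cases "k < n \<and> r < m")
    case True
    then show ?thesis
      using lookup_ev_psi_tm[of k n m s r] lookup_ev_psi_tm[of k n m s' r] assms(3) by simp
  next
    case False
    then have "n \<le> k \<or> m \<le> r" by linarith
    then show ?thesis using assms(1,2) by (auto simp: Mat_def)
  qed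
qed

section \<open>Soundness of the monoidal ideal\<close>

text \<open>Links the generating vectors, which depend on the field, to the coefficient-free
  relation used for the quotient type.\<close>

lemma V_CommCocHopf_eq:
  "(m, n, v) \<in> V_CommCocHopf \<longleftrightarrow> (\<exists>t t'. hopf_axiom t t' \<and> m = src t \<and> n = tgt t \<and> v = lc_diff t t')"
proof
  let ?S = "{(src t, tgt t, lc_diff t t') | t t'. hopf_axiom t t'}"
  have S: "(m, n, lc_diff t t') \<in> ?S" if "hopf_axiom t t'" "src t = m" "tgt t = n" for m n t t'
    using that by blast
  have "V_CommCocHopf \<subseteq> ?S"
    unfolding V_CommCocHopf_def V_Hopf_def
    by (intro Un_least insert_subsetI empty_subsetI; rule S, rule hopf_axiom.intros, simp, simp)
  moreover assume "(m, n, v) \<in> V_CommCocHopf"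
  ultimately show "\<exists>t t'. hopf_axiom t t' \<and> m = src t \<and> n = tgt t \<and> v = lc_diff t t'"
    by blast
next
  assume "\<exists>t t'. hopf_axiom t t' \<and> m = src t \<and> n = tgt t \<and> v = lc_diff t t'"
  then obtain t t' where "hopf_axiom t t'" and [simp]: "m = src t" "n = tgt t" "v = lc_diff t t'"
    by blast
  from this(1) show "(m, n, v) \<in> V_CommCocHopf"
    by cases (simp_all add: V_CommCocHopf_def V_Hopf_def)
qed

lemma lc_diff_eq: "lc_diff t t' = (\<lambda>h. lc_of t h - lc_of t' h)"
  by (simp add: lc_diff_def)

lemma lc_of_congruence:
  "lc_compR (lc_diff a b) g = lc_diff (Comp a g) (Comp b g)"
  "lc_compL g (lc_diff a b) = lc_diff (Comp g a) (Comp g b)"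
  "lc_tensR (lc_diff a b) g = lc_diff (Tens a g) (Tens b g)"
  "lc_tensL g (lc_diff a b) = lc_diff (Tens g a) (Tens g b)"
  by (auto simp: fun_eq_iff lc_compR_def lc_compL_def lc_tensR_def lc_tensL_def lc_diff_def lc_of_def
      split: tm.split)

lemma inI_lc_diff_trans:
  assumes "inI V m n (lc_diff a b)" "inI V m n (lc_diff b c)"
  shows "inI V m n (lc_diff a c)"
  using inI.add[OF assms] by (simp add: lc_diff_def)

lemma inI_lc_diff_sym: "inI V m n (lc_diff a b) \<Longrightarrow> inI V m n (lc_diff b a)"
  using inI.smult[of V m n "lc_diff a b" "- 1"] by (simp add: lc_diff_def)

text \<open>The ideal is closed under operations on one argument at a time. For \<open>Comp\<close>
  and \<open>Tens\<close> the two changes are made successively, passing through the mixed term with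
  \<open>f'\<close> and \<open>g\<close>.\<close>

lemma eqv_imp_inI:
  "eqv t t' \<Longrightarrow> inI (V_CommCocHopf :: (nat \<times> nat \<times> 'k::field lc) set) (src t) (tgt t) (lc_diff t t')"
  (is "_ \<Longrightarrow> inI ?V _ _ _")
proof (induction rule: eqv.induct)
  case (eqv_beq t t')
  then show ?case
    using inI.rel[OF eqv_beq] beq_typed[OF eqv_beq] by (simp add: lc_diff_def)
next
  case (eqv_axiom t t')
  then show ?case
    by (intro inI.gen) (auto simp: V_CommCocHopf_eq)
next
  case (eqv_refl t)
  then show ?case
    using inI.zero by (simp add: lc_diff_def)
next
  case (eqv_sym t t')
  then show ?case
    using inI_lc_diff_sym eqv_typed[OF eqv_sym.hyps] by simp
next
  case (eqv_trans t t' t'')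
  then show ?case
    using eqv_typed[OF eqv_trans.hyps(1)] by (auto intro: inI_lc_diff_trans)
next
  case (eqv_Comp f f' g g')
  note f = eqv_typed[OF eqv_Comp.hyps(1)] and g = eqv_typed[OF eqv_Comp.hyps(2)]
  have "inI ?V (src g) (tgt f) (lc_diff (Comp f g) (Comp f' g))"
    using inI.compR[OF eqv_Comp.IH(1), of g] g eqv_Comp.hyps(3) by (simp add: lc_of_congruence)
  moreover have "inI ?V (src g) (tgt f) (lc_diff (Comp f' g) (Comp f' g'))"
    using inI.compL[OF eqv_Comp.IH(2), of f'] f g eqv_Comp.hyps(3) by (simp add: lc_of_congruence)
  ultimately show ?case
    by (auto intro: inI_lc_diff_trans)
next
  case (eqv_Tens f f' g g')
  note f = eqv_typed[OF eqv_Tens.hyps(1)] and g = eqv_typed[OF eqv_Tens.hyps(2)]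
  have "inI ?V (src f + src g) (tgt f + tgt g) (lc_diff (Tens f g) (Tens f' g))"
    using inI.tensR[OF eqv_Tens.IH(1), of g] g by (simp add: lc_of_congruence)
  moreover have "inI ?V (src f + src g) (tgt f + tgt g) (lc_diff (Tens f' g) (Tens f' g'))"
    using inI.tensL[OF eqv_Tens.IH(2), of f'] f by (simp add: lc_of_congruence)
  ultimately show ?case
    by (auto intro: inI_lc_diff_trans)
qed

text \<open>Every structure map of a group algebra sends a basis vector to a single basis vector
  with coefficient 1, so the sum defining a composite has one nonzero summand. The linear action
  thereby reduces to the function \<open>ev\<close> on lists.\<close>

lemma evH_eq_delta:
  "wf t \<Longrightarrow> length xs = src t \<Longrightarrow> (evH t xs :: grp list \<Rightarrow> 'k::field) = delta (ev t xs)"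
proof (induction t arbitrary: xs)
  case (Gen w)
  then have "length xs = gsrc w" by simp
  then show ?case by (cases rule: gen_ev_cases) auto
next
  case (Comp f g)
  then show ?case
    by (simp add: Comp.IH(2)) (simp add: delta_def Comp.IH(1))
next
  case (Tens f g)
  have f: "(evH f (take (src f) xs) :: grp list \<Rightarrow> 'k) = delta (ev f (take (src f) xs))"
    using Tens.prems by (intro Tens.IH) simp_all
  have g: "(evH g (drop (src f) xs) :: grp list \<Rightarrow> 'k) = delta (ev g (drop (src f) xs))"
    using Tens.prems by (intro Tens.IH) simp_all
  have len: "length (ev f (take (src f) xs)) = tgt f"
    using Tens.prems by simp
  show ?case
  proof
    fix ys
    have "ev f (take (src f) xs) @ ev g (drop (src f) xs) = ys \<longleftrightarrow>
        ev f (take (src f) xs) = take (tgt f) ys \<and> ev g (drop (src f) xs) = drop (tgt f) ys"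
      using len by (metis append_eq_conv_conj)
    then show "(evH (Tens f g) xs ys :: 'k) = delta (ev (Tens f g) xs) ys"
      by (simp add: f g delta_def)
  qed
qed simp_all

lemma length_split3:
  assumes "length xs = l + m + n"
  obtains as bs cs where "xs = as @ bs @ cs" "length as = l" "length bs = m" "length cs = n"
proof
  show "xs = take l xs @ take m (drop l xs) @ drop m (drop l xs)"
    by (simp only: append_take_drop_id)
qed (use assms in simp_all)

text \<open>\<open>beq\<close> consists of bare relations without congruence rules, so a case
  distinction is enough. Associativity of the tensor and the hexagons act on three consecutive
  blocks, for which the input list is split.\<close>

lemma beq_sound: "beq t t' \<Longrightarrow> length xs = src t \<Longrightarrow> ev t xs = ev t' xs"
proof (induction rule: beq.cases)
  case (tassoc f g h)
  then have "length xs = src f + src g + src h" by simp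
  then obtain as bs cs where "xs = as @ bs @ cs" "length as = src f" "length bs = src g" "length cs = src h"
    by (rule length_split3)
  then show ?case
    using tassoc by simp
next
  case (hex1 l m n)
  then have "length xs = l + m + n" by simp
  then obtain as bs cs where "xs = as @ bs @ cs" "length as = l" "length bs = m" "length cs = n"
    by (rule length_split3)
  then show ?case
    using hex1 by simp
next
  case (hex2 l m n)
  then have "length xs = l + m + n" by simp
  then obtain as bs cs where "xs = as @ bs @ cs" "length as = l" "length bs = m" "length cs = n"
    by (rule length_split3)
  then show ?case
    using hex2 by simp
qed simp_all

lemma hopf_axiom_sound:
  assumes "hopf_axiom t t'" "length xs = src t"
  shows "ev t xs = ev t' xs"
  using assms
  by cases (auto simp: numeral_2_eq_2 numeral_3_eq_3 length_Suc_conv add.assoc add.commute)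

section \<open>Linear functionals on combinations of terms\<close>

definition lsum :: "'k::field lc \<Rightarrow> (tm \<Rightarrow> 'k) \<Rightarrow> 'k" where
  "lsum c F = (\<Sum>t\<in>{t. c t \<noteq> 0}. c t * F t)"

lemma lsum_superset:
  "finite S \<Longrightarrow> {t. c t \<noteq> 0} \<subseteq> S \<Longrightarrow> lsum c F = (\<Sum>t\<in>S. c t * F t)"
  unfolding lsum_def by (rule sum.mono_neutral_left) auto

lemma lsum_add:
  assumes "finite {t. a t \<noteq> 0}" "finite {t. b t \<noteq> 0}"
  shows "lsum (\<lambda>t. a t + b t) F = lsum a F + lsum b F"
proof -
  let ?S = "{t. a t \<noteq> 0} \<union> {t. b t \<noteq> 0}"
  have "lsum (\<lambda>t. a t + b t) F = (\<Sum>t\<in>?S. (a t + b t) * F t)"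
    "lsum a F = (\<Sum>t\<in>?S. a t * F t)" "lsum b F = (\<Sum>t\<in>?S. b t * F t)"
    using assms by (auto intro!: lsum_superset)
  then show ?thesis
    by (simp add: sum.distrib algebra_simps)
qed

lemma lsum_smult: "lsum (\<lambda>t. k * a t) F = k * lsum a F"
  \<comment> \<open>The range of summation is the support of the coefficients: it becomes empty for
    \<open>k = 0\<close> and is unchanged otherwise.\<close>
  by (cases "k = 0") (simp_all add: lsum_def sum_distrib_left algebra_simps)

lemma lsum_lc_diff: "lsum (lc_diff t t') F = F t - F t'"
proof -
  have "lsum (lc_diff t t') F = (\<Sum>h\<in>{t, t'}. lc_diff t t' h * F h)"
    by (rule lsum_superset) (auto simp: lc_diff_def lc_of_def split: if_splits)
  then show ?thesis
    by (cases "t = t'") (simp_all add: lc_diff_def lc_of_def)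
qed

lemma lsum_reindex:
  assumes "inj T" "\<And>f. b (T f) = a f" "\<And>h. h \<notin> range T \<Longrightarrow> b h = 0"
  shows "{h. b h \<noteq> 0} = T ` {f. a f \<noteq> 0}" "lsum b F = lsum a (\<lambda>f. F (T f))"
proof -
  show *: "{h. b h \<noteq> 0} = T ` {f. a f \<noteq> 0}"
    using assms(2,3) by force
  show "lsum b F = lsum a (\<lambda>f. F (T f))"
    unfolding lsum_def * using inj_on_subset[OF assms(1)]
    by (subst sum.reindex) (auto simp: assms(2))
qed

text \<open>Quantifying over arbitrary functionals \<open>\<phi>\<close>, rather than over coefficients of basis vectors,
  makes each closure property of the ideal a mere substitution for \<open>xs\<close> or \<open>\<phi>\<close>.\<close>
definition vanishing :: "nat \<Rightarrow> nat \<Rightarrow> 'k::field lc \<Rightarrow> bool" where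
  "vanishing m n c \<longleftrightarrow> c \<in> Pmn m n \<and> (\<forall>xs \<phi>. length xs = m \<longrightarrow> lsum c (\<lambda>t. \<phi> (ev t xs)) = 0)"

lemma vanishingD: "vanishing m n c \<Longrightarrow> length xs = m \<Longrightarrow> lsum c (\<lambda>t. \<phi> (ev t xs)) = 0"
  by (simp add: vanishing_def)

lemma vanishing_lc_diff:
  assumes "wf t" "wf t'" "src t = src t'" "tgt t = tgt t'" "\<And>xs. length xs = src t \<Longrightarrow> ev t xs = ev t' xs"
  shows "vanishing (src t) (tgt t) (lc_diff t t')"
proof -
  have "finite {h. lc_diff t t' h \<noteq> (0 :: 'a)}"
    by (rule finite_subset[of _ "{t, t'}"]) (auto simp: lc_diff_def lc_of_def split: if_splits)
  then have "lc_diff t t' \<in> (Pmn (src t) (tgt t) :: 'a lc set)"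
    using assms(1-4) by (auto simp: Pmn_def lc_diff_def lc_of_def split: if_splits)
  then show ?thesis
    using assms(5) by (simp add: vanishing_def lsum_lc_diff)
qed

text \<open>Treats the four closure rules of the ideal at once. \<open>T\<close> is composition or
  tensoring with a fixed term, \<open>xs'\<close> is the input that reaches the varying term, and
  \<open>\<gamma>\<close> is what happens to its output; the functional \<open>\<phi>\<close> is
  then replaced by \<open>\<phi>\<close> after \<open>\<gamma>\<close>.\<close>

lemma vanishing_reindex:
  assumes v: "vanishing m n a" and T: "inj T" "\<And>f. b (T f) = a f" "\<And>h. h \<notin> range T \<Longrightarrow> b h = 0"
    and typed: "\<And>f. wf f \<Longrightarrow> src f = m \<Longrightarrow> tgt f = n \<Longrightarrow> wf (T f) \<and> src (T f) = m' \<and> tgt (T f) = n'"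
    and ev: "\<And>xs. length xs = m' \<Longrightarrow> \<exists>xs' \<gamma>. length xs' = m \<and>
      (\<forall>f. wf f \<longrightarrow> src f = m \<longrightarrow> tgt f = n \<longrightarrow> ev (T f) xs = \<gamma> (ev f xs'))"
  shows "vanishing m' n' b"
  unfolding vanishing_def
proof (intro conjI allI impI)
  have a: "a \<in> Pmn m n"
    using v by (simp add: vanishing_def)
  have supp: "{h. b h \<noteq> 0} = T ` {f. a f \<noteq> 0}"
    by (rule lsum_reindex) (rule T)+
  have "finite {h. b h \<noteq> 0}"
    unfolding supp using a by (simp add: Pmn_def)
  moreover have "wf h \<and> src h = m' \<and> tgt h = n'" if "b h \<noteq> 0" for h
  proof -
    from that have "h \<in> T ` {f. a f \<noteq> 0}"
      using supp by blast
    then show ?thesis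
      using a typed by (auto simp: Pmn_def)
  qed
  ultimately show "b \<in> Pmn m' n'"
    by (simp add: Pmn_def)
  fix xs :: "grp list" and \<phi> :: "grp list \<Rightarrow> 'a"
  assume "length xs = m'"
  then obtain xs' \<gamma> where xs': "length xs' = m"
    and \<gamma>: "\<forall>f. wf f \<longrightarrow> src f = m \<longrightarrow> tgt f = n \<longrightarrow> ev (T f) xs = \<gamma> (ev f xs')"
    using ev by blast
  have "lsum b (\<lambda>t. \<phi> (ev t xs)) = lsum a (\<lambda>f. \<phi> (ev (T f) xs))"
    by (rule lsum_reindex) (rule T)+
  also have "\<dots> = lsum a (\<lambda>f. \<phi> (\<gamma> (ev f xs')))"
    unfolding lsum_def using a \<gamma> by (intro sum.cong) (auto simp: Pmn_def)
  also have "\<dots> = 0"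
    by (rule vanishingD[OF v xs'])
  finally show "lsum b (\<lambda>t. \<phi> (ev t xs)) = 0" .
qed

text \<open>Serves two purposes: the relations are identities of the group algebra, and nothing in
  the ideal can be detected by functionals of evaluations, which yields injectivity.\<close>

lemma inI_imp_vanishing: "inI V_CommCocHopf m n a \<Longrightarrow> vanishing m n a"
proof (induction rule: inI.induct)
  case (gen m n v)
  then show ?case
    by (auto simp: V_CommCocHopf_eq hopf_axiom_typed hopf_axiom_sound intro!: vanishing_lc_diff)
next
  case (rel t t')
  then show ?case
    unfolding lc_diff_eq[symmetric]
    using beq_typed[OF rel(1)] beq_sound[OF rel(1)] by (intro vanishing_lc_diff) auto
next
  case (zero m n)
  then show ?case
    by (simp add: vanishing_def Pmn_def lsum_def)
next
  case (add m n a b)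
  then have fin: "finite {t. a t \<noteq> 0}" "finite {t. b t \<noteq> 0}"
    by (auto simp: vanishing_def Pmn_def)
  have "{t. a t + b t \<noteq> 0} \<subseteq> {t. a t \<noteq> 0} \<union> {t. b t \<noteq> 0}"
    by auto
  then have "finite {t. a t + b t \<noteq> 0}"
    using fin by (meson finite_UnI finite_subset)
  moreover have "wf t \<and> src t = m \<and> tgt t = n" if "a t + b t \<noteq> 0" for t
  proof -
    have "a t \<noteq> 0 \<or> b t \<noteq> 0" using that by auto
    then show ?thesis using add.IH by (auto simp: vanishing_def Pmn_def)
  qed
  ultimately show ?case
    using add.IH lsum_add[OF fin] by (simp add: vanishing_def Pmn_def)
next
  case (smult m n a k)
  have "{t. k * a t \<noteq> 0} \<subseteq> {t. a t \<noteq> 0}"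
    by auto
  then have "finite {t. k * a t \<noteq> 0}"
    using smult.IH by (auto simp: vanishing_def Pmn_def intro: finite_subset)
  then show ?case
    using smult.IH by (simp add: vanishing_def Pmn_def lsum_smult)
next
  case (compR m n a g)
  show ?case
  proof (rule vanishing_reindex[OF compR.IH, of "\<lambda>f. Comp f g"])
    show "\<exists>xs' \<gamma>. length xs' = m \<and> (\<forall>f. wf f \<longrightarrow> src f = m \<longrightarrow> tgt f = n \<longrightarrow>
        ev (Comp f g) xs = \<gamma> (ev f xs'))" if "length xs = src g" for xs
      using compR that by (intro exI[of _ "ev g xs"] exI[of _ "\<lambda>z. z"]) simp
    show "inj (\<lambda>f. Comp f g)"
      by (simp add: inj_def)
    show "lc_compR a g (Comp f g) = a f" for f
      by (simp add: lc_compR_def)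
    show "lc_compR a g h = 0" if "h \<notin> range (\<lambda>f. Comp f g)" for h
      using that by (cases h) (auto simp: lc_compR_def)
  qed (use compR in auto)
next
  case (compL m n a g)
  show ?case
  proof (rule vanishing_reindex[OF compL.IH, of "Comp g"])
    show "\<exists>xs' \<gamma>. length xs' = m \<and> (\<forall>f. wf f \<longrightarrow> src f = m \<longrightarrow> tgt f = n \<longrightarrow>
        ev (Comp g f) xs = \<gamma> (ev f xs'))" if "length xs = m" for xs
      using that by (intro exI[of _ xs] exI[of _ "ev g"]) simp
    show "inj (Comp g)"
      by (simp add: inj_def)
    show "lc_compL g a (Comp g f) = a f" for f
      by (simp add: lc_compL_def)
    show "lc_compL g a h = 0" if "h \<notin> range (Comp g)" for h
      using that by (cases h) (auto simp: lc_compL_def)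
  qed (use compL in auto)
next
  case (tensR m n a g)
  show ?case
  proof (rule vanishing_reindex[OF tensR.IH, of "\<lambda>f. Tens f g"])
    show "\<exists>xs' \<gamma>. length xs' = m \<and> (\<forall>f. wf f \<longrightarrow> src f = m \<longrightarrow> tgt f = n \<longrightarrow>
        ev (Tens f g) xs = \<gamma> (ev f xs'))" if "length xs = m + src g" for xs
      using that by (intro exI[of _ "take m xs"] exI[of _ "\<lambda>z. z @ ev g (drop m xs)"]) simp
    show "inj (\<lambda>f. Tens f g)"
      by (simp add: inj_def)
    show "lc_tensR a g (Tens f g) = a f" for f
      by (simp add: lc_tensR_def)
    show "lc_tensR a g h = 0" if "h \<notin> range (\<lambda>f. Tens f g)" for h
      using that by (cases h) (auto simp: lc_tensR_def)
  qed (use tensR in auto)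
next
  case (tensL m n a g)
  show ?case
  proof (rule vanishing_reindex[OF tensL.IH, of "Tens g"])
    show "\<exists>xs' \<gamma>. length xs' = m \<and> (\<forall>f. wf f \<longrightarrow> src f = m \<longrightarrow> tgt f = n \<longrightarrow>
        ev (Tens g f) xs = \<gamma> (ev f xs'))" if "length xs = src g + m" for xs
      using that by (intro exI[of _ "drop (src g) xs"] exI[of _ "\<lambda>z. ev g (take (src g) xs) @ z"]) simp
    show "inj (Tens g)"
      by (simp add: inj_def)
    show "lc_tensL g a (Tens g f) = a f" for f
      by (simp add: lc_tensL_def)
    show "lc_tensL g a h = 0" if "h \<notin> range (Tens g)" for h
      using that by (cases h) (auto simp: lc_tensL_def)
  qed (use tensL in auto)
qed

lemma is_identity_iff:
  assumes "c \<in> Pmn m n"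
  shows "is_identity m n c \<longleftrightarrow> (\<forall>xs ys. length xs = m \<longrightarrow> lsum c (\<lambda>t. delta (ev t xs) ys) = 0)"
proof -
  have "(\<Sum>t\<in>{t. c t \<noteq> 0}. c t * evH t xs ys) = lsum c (\<lambda>t. delta (ev t xs) ys)" if "length xs = m" for xs ys
    unfolding lsum_def using assms that
    by (intro sum.cong) (auto simp: Pmn_def evH_eq_delta)
  then show ?thesis
    by (simp add: is_identity_def)
qed

lemma vanishing_imp_is_identity: "vanishing m n c \<Longrightarrow> is_identity m n c"
  using vanishingD[of m n c _ "\<lambda>z. delta z _"] by (auto simp: vanishing_def is_identity_iff)

section \<open>Linear combinations of normal forms\<close>

lemma inI_sum:
  assumes "finite T" "\<And>t. t \<in> T \<Longrightarrow> inI V m n (f t)"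
  shows "inI V m n (\<lambda>h. \<Sum>t\<in>T. k t * f t h)"
  using assms
proof (induction T rule: finite_induct)
  case empty
  then show ?case by (simp add: inI.zero)
next
  case (insert t T)
  then have "inI V m n (\<lambda>h. k t * f t h + (\<Sum>t\<in>T. k t * f t h))"
    by (intro inI.add inI.smult) auto
  then show ?case
    using insert.hyps by simp
qed

text \<open>The inverse of \<open>psi_lin\<close> on representatives: coefficients of all terms with
  the same normal form are collected.\<close>

definition mat_coeff :: "'k::field lc \<Rightarrow> (nat \<Rightarrow> nat \<Rightarrow> int) \<Rightarrow> 'k" where
  "mat_coeff c s = (\<Sum>t\<in>{t. c t \<noteq> 0 \<and> mat_of t = s}. c t)"

lemma mat_coeff_support: "{s. mat_coeff c s \<noteq> 0} \<subseteq> mat_of ` {t. c t \<noteq> 0}"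
proof
  fix s assume "s \<in> {s. mat_coeff c s \<noteq> 0}"
  then have "{t. c t \<noteq> 0 \<and> mat_of t = s} \<noteq> {}"
    unfolding mat_coeff_def by (metis (mono_tags, lifting) mem_Collect_eq sum.empty)
  then show "s \<in> mat_of ` {t. c t \<noteq> 0}" by auto
qed

lemma mat_coeff_Dom:
  assumes "c \<in> Pmn m n"
  shows "mat_coeff c \<in> Dom m n"
proof -
  have "finite {s. mat_coeff c s \<noteq> 0}"
    using assms by (intro finite_subset[OF mat_coeff_support]) (simp add: Pmn_def)
  moreover have "s \<in> Mat m n" if nonzero: "mat_coeff c s \<noteq> 0" for s
  proof -
    obtain t where "c t \<noteq> 0" "s = mat_of t"
      using nonzero mat_coeff_support[of c] by blast
    then show ?thesis
      using assms mat_of_Mat[of t] by (auto simp: Pmn_def)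
  qed
  ultimately show ?thesis
    by (simp add: Dom_def)
qed

text \<open>Replacing each term by its normal form changes the combination by a sum of multiples of
  differences, each in the ideal by \<open>eqv_psi_tm\<close>. This gives surjectivity.\<close>

lemma inI_psi_lin_mat_coeff:
  fixes c :: "'k::field lc"
  assumes c: "c \<in> Pmn m n"
  shows "inI V_CommCocHopf m n (\<lambda>h. c h - psi_lin m n (mat_coeff c) h)"
proof -
  let ?T = "{t. c t \<noteq> 0}" and ?psi = "\<lambda>t. psi_tm m n (mat_of t)"
  have T: "finite ?T" and typed: "\<And>t. t \<in> ?T \<Longrightarrow> wf t \<and> src t = m \<and> tgt t = n"
    using c by (auto simp: Pmn_def)
  have psi: "psi_lin m n (mat_coeff c) h = (\<Sum>t\<in>?T. c t * lc_of (?psi t) h)" for h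
  proof -
    have "psi_lin m n (mat_coeff c) h = (\<Sum>s\<in>mat_of ` ?T. mat_coeff c s * lc_of (psi_tm m n s) h)"
      unfolding psi_lin_def using T mat_coeff_support[of c] by (intro sum.mono_neutral_left) auto
    \<comment> \<open>The sum over terms is regrouped along the fibres of
      \<open>mat_of\<close>.\<close>
    also have "\<dots> = (\<Sum>s\<in>mat_of ` ?T. \<Sum>t\<in>{t \<in> ?T. mat_of t = s}. c t * lc_of (?psi t) h)"
      unfolding mat_coeff_def sum_distrib_right by (intro sum.cong) auto
    also have "\<dots> = (\<Sum>t\<in>?T. c t * lc_of (?psi t) h)"
      using T by (rule sum.image_gen[symmetric])
    finally show ?thesis .
  qed
  have "(\<Sum>t\<in>?T. c t * lc_of t h) = c h" for h
    using T by (auto simp: lc_of_def if_distrib cong: if_cong)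
  then have "c h - psi_lin m n (mat_coeff c) h = (\<Sum>t\<in>?T. c t * lc_diff t (?psi t) h)" for h
    by (simp add: lc_diff_def right_diff_distrib sum_subtractf psi)
  moreover have "inI V_CommCocHopf m n (lc_diff t (?psi t) :: 'k lc)" if "t \<in> ?T" for t
    using eqv_imp_inI[OF eqv_psi_tm[of t]] typed[OF that] by auto
  then have "inI V_CommCocHopf m n (\<lambda>h. \<Sum>t\<in>?T. c t * lc_diff t (?psi t) h)"
    using T by (intro inI_sum)
  ultimately show ?thesis by simp
qed

lemma psi_lin_support: "{t. psi_lin m n c t \<noteq> 0} \<subseteq> psi_tm m n ` {s. c s \<noteq> 0}"
proof
  fix t assume "t \<in> {t. psi_lin m n c t \<noteq> 0}"
  then have "(\<Sum>s\<in>{s. c s \<noteq> 0}. c s * lc_of (psi_tm m n s) t) \<noteq> 0"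
    by (simp add: psi_lin_def)
  then obtain s where "s \<in> {s. c s \<noteq> 0}" "c s * lc_of (psi_tm m n s) t \<noteq> 0"
    by (rule sum.not_neutral_contains_not_neutral)
  then show "t \<in> psi_tm m n ` {s. c s \<noteq> 0}"
    by (auto simp: lc_of_def split: if_splits)
qed

lemma psi_lin_Pmn:
  assumes "c \<in> Dom m n"
  shows "psi_lin m n c \<in> Pmn m n"
proof -
  have "finite {t. psi_lin m n c t \<noteq> 0}"
    using assms by (intro finite_subset[OF psi_lin_support]) (simp add: Dom_def)
  moreover have "wf t \<and> src t = m \<and> tgt t = n" if nonzero: "psi_lin m n c t \<noteq> 0" for t
  proof -
    obtain s where "t = psi_tm m n s"
      using nonzero psi_lin_support[of m n c] by blast
    then show ?thesis
      by (simp add: psi_tm_typed)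
  qed
  ultimately show ?thesis
    by (simp add: Pmn_def)
qed

text \<open>The coefficient of a term in \<open>psi_lin m n c\<close> is itself a sum over all
  matrices whose normal form is that term. Exchanging the two sums leaves one term for each
  matrix.\<close>

lemma lsum_psi_lin:
  assumes "finite {s. c s \<noteq> 0}"
  shows "lsum (psi_lin m n c) F = (\<Sum>s\<in>{s. c s \<noteq> 0}. c s * F (psi_tm m n s))"
proof -
  let ?S = "{s. c s \<noteq> 0}"
  let ?P = "psi_tm m n ` ?S"
  have "lsum (psi_lin m n c) F = (\<Sum>t\<in>?P. psi_lin m n c t * F t)"
    using assms by (intro lsum_superset finite_imageI psi_lin_support)
  also have "\<dots> = (\<Sum>t\<in>?P. \<Sum>s\<in>?S. c s * lc_of (psi_tm m n s) t * F t)"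
    by (simp add: psi_lin_def sum_distrib_right)
  also have "\<dots> = (\<Sum>s\<in>?S. \<Sum>t\<in>?P. c s * lc_of (psi_tm m n s) t * F t)"
    by (rule sum.swap)
  also have "\<dots> = (\<Sum>s\<in>?S. \<Sum>t\<in>?P. if t = psi_tm m n s then c s * F t else 0)"
    by (intro sum.cong) (auto simp: lc_of_def)
  also have "\<dots> = (\<Sum>s\<in>?S. c s * F (psi_tm m n s))"
    using assms by (intro sum.cong) (auto simp: sum.delta)
  finally show ?thesis .
qed

text \<open>The indicator of the value of one normal form on free generators is a dual basis
  functional, since different matrices have different values there.\<close>

lemma lsum_psi_lin_indicator:
  fixes c :: "_ \<Rightarrow> 'k::field"
  assumes "c \<in> Dom m n" "s \<in> Mat m n"
  shows "lsum (psi_lin m n c) (\<lambda>t. if ev t (basis m) = ev (psi_tm m n s) (basis m) then 1 else 0) = c s"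
proof -
  have fin: "finite {s. c s \<noteq> 0}"
    using assms(1) by (simp add: Dom_def)
  have "lsum (psi_lin m n c) (\<lambda>t. if ev t (basis m) = ev (psi_tm m n s) (basis m) then 1 else 0)
      = (\<Sum>s'\<in>{s. c s \<noteq> 0}. if s' = s then c s' else 0)"
    unfolding lsum_psi_lin[OF fin]
    using assms by (intro sum.cong) (auto simp: Dom_def dest: psi_tm_eq_imp_mat_eq)
  also have "\<dots> = c s"
    using fin by (simp add: sum.delta)
  finally show ?thesis .
qed

lemma psi_lin_inject:
  fixes c :: "_ \<Rightarrow> 'k::field"
  assumes "c \<in> Dom m n" "c' \<in> Dom m n"
    and "inI V_CommCocHopf m n (\<lambda>h. psi_lin m n c h - psi_lin m n c' h)"
  shows "c = c'"
proof
  fix s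
  show "c s = c' s"
  proof (cases "s \<in> Mat m n")
    case True
    let ?F = "\<lambda>t. if ev t (basis m) = ev (psi_tm m n s) (basis m) then 1 else 0 :: 'k"
    have fin: "finite {t. psi_lin m n c t \<noteq> 0}" "finite {t. - 1 * psi_lin m n c' t \<noteq> 0}"
      using psi_lin_Pmn[OF assms(1)] psi_lin_Pmn[OF assms(2)] by (auto simp: Pmn_def)
    have "0 = lsum (\<lambda>h. psi_lin m n c h - psi_lin m n c' h) ?F"
      using vanishingD[OF inI_imp_vanishing[OF assms(3)], of "basis m"
          "\<lambda>z. if z = ev (psi_tm m n s) (basis m) then 1 else 0"] by simp
    also have "\<dots> = lsum (psi_lin m n c) ?F + lsum (\<lambda>h. - 1 * psi_lin m n c' h) ?F"
      using lsum_add[OF fin, of ?F] by simp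
    also have "\<dots> = c s - c' s"
      unfolding lsum_smult using assms True by (simp add: lsum_psi_lin_indicator)
    finally show ?thesis by simp
  next
    case False
    then have "c s = 0" "c' s = 0"
      using assms(1,2) by (auto simp: Dom_def)
    then show ?thesis by simp
  qed
qed

text \<open>Testing an identity on the free generators is already decisive: the coefficient of one
  output basis vector is the sum of the coefficients of all terms with one fixed matrix.\<close>

lemma mat_coeff_eq_0:
  assumes c: "c \<in> Pmn m n" and id: "is_identity m n c"
  shows "mat_coeff c = (\<lambda>s. 0)"
proof
  fix s
  show "mat_coeff c s = 0"
  \<comment> \<open>A nonzero collected coefficient supplies a term \<open>u\<close> with matrix
    \<open>s\<close>; its value on the free generators is the output vector to test.\<close>
  proof (rule ccontr)
    assume "mat_coeff c s \<noteq> 0"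
    then obtain u where u: "c u \<noteq> 0" and s: "s = mat_of u"
      using mat_coeff_support[of c] by blast
    have typed: "wf t \<and> src t = m \<and> tgt t = n" if "c t \<noteq> 0" for t
      using c that by (simp add: Pmn_def)
    have mat: "ev t (basis m) = ev u (basis m) \<longleftrightarrow> mat_of t = s" if "c t \<noteq> 0" for t
    proof
      assume "ev t (basis m) = ev u (basis m)"
      then show "mat_of t = s"
        using typed[OF that] typed[OF u] by (simp add: s mat_of_def fun_eq_iff)
    next
      assume "mat_of t = s"
      then show "ev t (basis m) = ev u (basis m)"
        using ev_basis_psi_tm[of t] ev_basis_psi_tm[of u] typed[OF that] typed[OF u] s by simp
    qed
    have "0 = lsum c (\<lambda>t. delta (ev t (basis m)) (ev u (basis m)))"
      using id by (simp add: is_identity_iff[OF c])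
    also have "\<dots> = (\<Sum>t\<in>{t. c t \<noteq> 0}. if mat_of t = s then c t else 0)"
      unfolding lsum_def by (intro sum.cong) (auto simp: delta_def mat)
    also have "\<dots> = mat_coeff c s"
      unfolding mat_coeff_def using c by (subst sum.inter_filter[symmetric]) (auto simp: Pmn_def)
    finally show False
      using \<open>mat_coeff c s \<noteq> 0\<close> by simp
  qed
qed

section \<open>Classes modulo the ideal\<close>

lemma inI_diff_cancel:
  assumes ab: "inI V m n (\<lambda>h. a h - b h)"
  shows "inI V m n (\<lambda>h. a h - d h) \<longleftrightarrow> inI V m n (\<lambda>h. b h - d h)"
proof
  assume "inI V m n (\<lambda>h. a h - d h)"
  then have "inI V m n (\<lambda>h. (a h - d h) + - 1 * (a h - b h))"
    by (intro inI.add inI.smult ab)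
  moreover have "(\<lambda>h. (a h - d h) + - 1 * (a h - b h)) = (\<lambda>h. b h - d h)"
    by auto
  ultimately show "inI V m n (\<lambda>h. b h - d h)"
    by (simp only:)
next
  assume "inI V m n (\<lambda>h. b h - d h)"
  then have "inI V m n (\<lambda>h. (a h - b h) + (b h - d h))"
    by (intro inI.add ab)
  moreover have "(\<lambda>h. (a h - b h) + (b h - d h)) = (\<lambda>h. a h - d h)"
    by auto
  ultimately show "inI V m n (\<lambda>h. a h - d h)"
    by (simp only:)
qed

lemma qcls_eq_iff:
  assumes "b \<in> Pmn m n"
  shows "qcls V m n a = qcls V m n b \<longleftrightarrow> inI V m n (\<lambda>h. a h - b h)"
proof
  assume eq: "qcls V m n a = qcls V m n b"
  have "b \<in> qcls V m n b"
    using assms by (simp add: qcls_def inI.zero)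
  then have "b \<in> qcls V m n a"
    unfolding eq .
  then show "inI V m n (\<lambda>h. a h - b h)"
    unfolding qcls_def by blast
next
  assume "inI V m n (\<lambda>h. a h - b h)"
  then show "qcls V m n a = qcls V m n b"
    unfolding qcls_def using inI_diff_cancel by blast
qed

lemma bij_betw_psi_lin:
  "bij_betw (\<lambda>c. qcls (V_CommCocHopf :: (nat \<times> nat \<times> 'k::field lc) set) m n (psi_lin m n c))
     (Dom m n) (qcls V_CommCocHopf m n ` Pmn m n)"
proof (rule bij_betw_imageI)
  show "inj_on (\<lambda>c. qcls (V_CommCocHopf :: (nat \<times> nat \<times> 'k lc) set) m n (psi_lin m n c)) (Dom m n)"
    by (rule inj_onI) (auto simp: qcls_eq_iff psi_lin_Pmn intro: psi_lin_inject)
  have "qcls V_CommCocHopf m n d \<in> (\<lambda>c. qcls V_CommCocHopf m n (psi_lin m n c)) ` Dom m n"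
    if "d \<in> Pmn m n" for d :: "'k lc"
    using that inI_psi_lin_mat_coeff[OF that] mat_coeff_Dom[OF that]
    by (intro image_eqI[of _ _ "mat_coeff d"]) (simp_all add: qcls_eq_iff psi_lin_Pmn)
  then show "(\<lambda>c. qcls (V_CommCocHopf :: (nat \<times> nat \<times> 'k lc) set) m n (psi_lin m n c)) ` Dom m n
      = qcls V_CommCocHopf m n ` Pmn m n"
    by (auto simp: psi_lin_Pmn)
qed

lemma generates_identities_V_CommCocHopf:
  "generates_identities (V_CommCocHopf :: (nat \<times> nat \<times> 'k::field lc) set)"
proof -
  have "is_identity m n v" if "(m, n, v) \<in> (V_CommCocHopf :: (nat \<times> nat \<times> 'k lc) set)" for m n v
    using inI_imp_vanishing[OF inI.gen[OF that]] by (rule vanishing_imp_is_identity)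
  \<comment> \<open>For an identity all collected coefficients vanish, so its normal form is the
    zero combination and the combination itself lies in the ideal.\<close>
  moreover have "inI V_CommCocHopf m n c" if "c \<in> Pmn m n" "is_identity m n c" for m n and c :: "'k lc"
    using inI_psi_lin_mat_coeff[OF that(1)] mat_coeff_eq_0[OF that] by (simp add: psi_lin_def)
  ultimately show ?thesis
    by (auto simp: generates_identities_def)
qed

theorem mainTheorem9:
  shows "(\<forall>m n. bij_betw (\<lambda>c. qcls (V_CommCocHopf :: (nat \<times> nat \<times> 'k::field lc) set) m n (psi_lin m n c))
                     (Dom m n) (qcls V_CommCocHopf m n ` Pmn m n))
       \<and> generates_identities (V_CommCocHopf :: (nat \<times> nat \<times> 'k::field lc) set)"
  using bij_betw_psi_lin generates_identities_V_CommCocHopf by blast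

end
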